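(* Let $k'\in\mathcal{K}_\omega$ and $k\in\mathrm{conj}(k')$. Let $f\in L^1([a,b];\mathbb{R})$ be such that $I_a^{k'}f$ has an absolutely continuous representative. Then $$I_a^k \left(D_a^{k'}f\right)(x)=f(x)-(I_a^{k'}f)(a)\, \left(\frac{1}{\omega(x)}\frac{d}{dx}\right)\delta_{k,\mathbf{1}}(x,a),\quad \text{a.e. } x\in[a,b].$$
   Context: Let $a<b$ be real numbers, $\mathbb{R}_+=(0,+\infty)$, and $\Omega=\{(x,y)\in[a,b]\times[a,b] : x>y\}$. Fix a weight function $\omega:[a,b]\to\mathbb{R}_+$ such that $\omega,\omega^{-1}\in L^\infty([a,b];\mathbb{R})$, where $\omega^{-1}=1/\omega$. For a (measurable) kernel-function $k:\Omega\to\mathbb{R}_+$ put $F_k(y)=\int_y^b k(x,y)\omega(x)\,dx$ for $y\in[a,b)$ and $G_k(y)=\int_a^y k(y,x)\omega(x)\,dx$ for $y\in(a,b]$. Let $\mathcal{K}_\omega$ be the set of measurable $k:\Omega\to\mathbb{R}_+$ such that $F_k\in L^\infty([a,b);\mathbb{R})$ and $G_k\in L^\infty((a,b];\mathbb{R})$. For $k_1,k_2\in\mathcal{K}_\omega$ put $\delta_{k_1,k_2}(x,y)=\int_y^x k_1(x,z)k_2(z,y)\omega(z)\,dz$ for $(x,y)\in\Omega$. Kernels $k,k'\in\mathcal{K}_\omega$ are conjugate if $\delta_{k,k'}(x,y)=\delta_{k',k}(x,y)=1$ for all $(x,y)\in\Omega$; $\mathrm{conj}(k')$ is the set of $k\in\mathcal{K}_\omega$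 such that $k$ and $k'$ are conjugate. $\mathbf{1}\in\mathcal{K}_\omega$ is the unit kernel, $\mathbf{1}(x,y)=1$ for $(x,y)\in\Omega$; so $\delta_{k,\mathbf{1}}(x,a)=\int_a^x k(x,z)\omega(z)\,dz$. For $k\in\mathcal{K}_\omega$ and $f\in L^1([a,b];\mathbb{R})$ the left-sided $k$-integral is $(I_a^kf)(x)=\int_a^x k(x,y)f(y)\omega(y)\,dy$ for a.e. $x\in[a,b]$. A function in $L^1([a,b];\mathbb{R})$ has an absolutely continuous representative if it agrees a.e. with an absolutely continuous function on $[a,b]$, with which it is then identified; in particular $(I_a^{k'}f)(a)$ denotes the value at $a$ of the absolutely continuous representative of $I_a^{k'}f$. If $f\in L^1([a,b];\mathbb{R})$ and $I_a^{k'}f$ has an absolutely continuous representative, the left-sided $k'$-derivative of $f$ is $(D_a^{k'}f)(x)=\frac{1}{\omega(x)}\frac{d}{dx}(I_a^{k'}f)(x)$ for a.e. $x\in[a,b]$. *)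

theory Defs
  imports "HOL-Analysis.Analysis"
begin

text \<open>
  ``Measurable'' and ``almost everywhere'' refer to Lebesgue measure throughout.  Functions on a
  subset are total functions whose values off that subset are irrelevant: integrals involving
  kernels run over open or half-open intervals, so that a kernel is evaluated only on the triangle.
\<close>

definition Linfty_on :: "real set \<Rightarrow> (real \<Rightarrow> real) \<Rightarrow> bool" where
  "Linfty_on S f \<longleftrightarrow> f \<in> borel_measurable (lebesgue_on S) \<and>
     (\<exists>C. AE x in lebesgue_on S. \<bar>f x\<bar> \<le> C)"

definition weight :: "real \<Rightarrow> real \<Rightarrow> (real \<Rightarrow> real) \<Rightarrow> bool" where
  "weight a b \<omega> \<longleftrightarrow> (\<forall>x\<in>{a..b}. \<omega> x > 0) \<and>
     Linfty_on {a..b} \<omega> \<and> Linfty_on {a..b} (\<lambda>x. 1 / \<omega> x)"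

definition triangle :: "real \<Rightarrow> real \<Rightarrow> (real \<times> real) set" where
  "triangle a b = {(x, y). x \<in> {a..b} \<and> y \<in> {a..b} \<and> x > y}"

type_synonym kernel = "real \<Rightarrow> real \<Rightarrow> real"

definition F_ker :: "real \<Rightarrow> (real \<Rightarrow> real) \<Rightarrow> kernel \<Rightarrow> real \<Rightarrow> real" where
  "F_ker b \<omega> k y = (\<integral>x. k x y * \<omega> x \<partial>lebesgue_on {y<..b})"

definition G_ker :: "real \<Rightarrow> (real \<Rightarrow> real) \<Rightarrow> kernel \<Rightarrow> real \<Rightarrow> real" where
  "G_ker a \<omega> k y = (\<integral>x. k y x * \<omega> x \<partial>lebesgue_on {a..<y})"

text \<open>
  Membership of \<open>F_ker\<close> and \<open>G_ker\<close> in \<open>L\<^sup>\<infinity>\<close> includes that the integrals of the nonnegative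
  integrands are finite almost everywhere.  This is required explicitly because the Bochner
  integral of a non-integrable function is 0.
\<close>

definition kernels :: "real \<Rightarrow> real \<Rightarrow> (real \<Rightarrow> real) \<Rightarrow> kernel set" where
  "kernels a b \<omega> = {k.
     (\<lambda>(x, y). k x y) \<in> borel_measurable (lebesgue_on (triangle a b)) \<and>
     (\<forall>(x, y) \<in> triangle a b. k x y > 0) \<and>
     (AE y in lebesgue_on {a..<b}. integrable (lebesgue_on {y<..b}) (\<lambda>x. k x y * \<omega> x)) \<and>
     Linfty_on {a..<b} (F_ker b \<omega> k) \<and>
     (AE y in lebesgue_on {a<..b}. integrable (lebesgue_on {a..<y}) (\<lambda>x. k y x * \<omega> x)) \<and>
     Linfty_on {a<..b} (G_ker a \<omega> k)}"

text \<open>Where the integral diverges, \<open>ker_delta\<close> is 0, so \<open>ker_delta \<omega> k1 k2 x y = 1\<close> implies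
  that the integrand is integrable.\<close>

definition ker_delta :: "(real \<Rightarrow> real) \<Rightarrow> kernel \<Rightarrow> kernel \<Rightarrow> real \<Rightarrow> real \<Rightarrow> real" where
  "ker_delta \<omega> k1 k2 x y = (\<integral>z. k1 x z * k2 z y * \<omega> z \<partial>lebesgue_on {y<..<x})"

definition conjugate :: "real \<Rightarrow> real \<Rightarrow> (real \<Rightarrow> real) \<Rightarrow> kernel \<Rightarrow> kernel \<Rightarrow> bool" where
  "conjugate a b \<omega> k k' \<longleftrightarrow>
     (\<forall>(x, y) \<in> triangle a b. ker_delta \<omega> k k' x y = 1 \<and> ker_delta \<omega> k' k x y = 1)"

definition conj_set :: "real \<Rightarrow> real \<Rightarrow> (real \<Rightarrow> real) \<Rightarrow> kernel \<Rightarrow> kernel set" where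
  "conj_set a b \<omega> k' = {k \<in> kernels a b \<omega>. conjugate a b \<omega> k k'}"

definition unit_kernel :: kernel where
  "unit_kernel x y = 1"

definition abs_cont_on :: "real \<Rightarrow> real \<Rightarrow> (real \<Rightarrow> real) \<Rightarrow> bool" where
  "abs_cont_on a b f \<longleftrightarrow>
     (\<forall>\<epsilon>>0. \<exists>\<delta>>0. \<forall>P :: (real \<times> real) set.
        finite P \<and> (\<forall>(u, v) \<in> P. a \<le> u \<and> u < v \<and> v \<le> b) \<and>
        disjoint_family_on (\<lambda>(u, v). {u<..<v}) P \<and>
        (\<Sum>(u, v)\<in>P. v - u) < \<delta> \<longrightarrow>
        (\<Sum>(u, v)\<in>P. \<bar>f v - f u\<bar>) < \<epsilon>)"

definition is_ac_rep :: "real \<Rightarrow> real \<Rightarrow> (real \<Rightarrow> real) \<Rightarrow> (real \<Rightarrow> real) \<Rightarrow> bool" where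
  "is_ac_rep a b g h \<longleftrightarrow> abs_cont_on a b h \<and> (AE x in lebesgue_on {a..b}. g x = h x)"

definition has_ac_rep :: "real \<Rightarrow> real \<Rightarrow> (real \<Rightarrow> real) \<Rightarrow> bool" where
  "has_ac_rep a b g \<longleftrightarrow> (\<exists>h. is_ac_rep a b g h)"

text \<open>For \<open>a < b\<close>, the choice is unique on \<open>{a..b}\<close>, by continuity.\<close>

definition ac_rep :: "real \<Rightarrow> real \<Rightarrow> (real \<Rightarrow> real) \<Rightarrow> real \<Rightarrow> real" where
  "ac_rep a b g = (SOME h. is_ac_rep a b g h)"

definition k_integral :: "real \<Rightarrow> (real \<Rightarrow> real) \<Rightarrow> kernel \<Rightarrow> (real \<Rightarrow> real) \<Rightarrow> real \<Rightarrow> real" where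
  "k_integral a \<omega> k f x = (\<integral>y. k x y * f y * \<omega> y \<partial>lebesgue_on {a..<x})"

definition k_derivative ::
  "real \<Rightarrow> real \<Rightarrow> (real \<Rightarrow> real) \<Rightarrow> kernel \<Rightarrow> (real \<Rightarrow> real) \<Rightarrow> real \<Rightarrow> real" where
  "k_derivative a b \<omega> k f x = 1 / \<omega> x * deriv (ac_rep a b (k_integral a \<omega> k f)) x"

end

(*
  Let h be the absolutely continuous representative of I^{k'} f, and q = h'.  Then h is h(a) plus
  the integral of q.  By Tonelli, conjugacy says that I^k I^{k'} and I^{k'} I^k are both plain
  integration J u(x) = int_a^x u omega.  Hence
    J f = I^k I^{k'} f = I^k h = h(a) I^k 1 + I^k J (q/omega)
        = h(a) I^k 1 + I^k I^{k'} I^k (q/omega) = h(a) delta_{k,1}(., a) + J I^k (q/omega),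
  and Lebesgue differentiation of both sides gives the claim.  Inserting the composition of k' and
  k, which is 1, into delta_{k,1}(x, a) turns it into int_a^x k(s, a) omega(s) ds, so it is
  differentiable almost everywhere.  These identities hold for every x < b and not merely almost
  everywhere, which is what permits differentiating them.
*)
theory Submission
  imports Defs
begin

section \<open>Absolutely continuous functions\<close>

text \<open>The density \<open>q\<close> comes from the Radon-Nikodym theorem, which needs a
  measure. Since \<open>h\<close> need not be monotone, it is first split into increasing absolutely
  continuous functions by means of its positive variation. The main obstacle afterwards is the gap
  between "almost every" and "every". The bounds on \<open>F_ker\<close> and \<open>G_ker\<close>
  and the measurability of sections hold almost everywhere, whereas an identity can be
  differentiated only if it holds on a neighbourhood. Conjugacy is the one pointwise condition on
  the kernels, and it closes the gap: it gives measurable rows at every \<open>x\<close>, and it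
  makes the composed kernel an indicator for every pair of arguments. The replacement of the
  \<open>k'\<close>-integral of \<open>f\<close> by \<open>h\<close> then takes place under an outer
  integral, where null sets are invisible. The restriction to \<open>x < b\<close> comes from the
  finiteness of row integrals: it is inherited from some good row between \<open>x\<close> and
  \<open>b\<close>.\<close>

definition intervals_in :: "real \<Rightarrow> real \<Rightarrow> (real \<times> real) set \<Rightarrow> bool" where
  "intervals_in x y S \<longleftrightarrow> finite S \<and> (\<forall>(u, v)\<in>S. x \<le> u \<and> u < v \<and> v \<le> y) \<and>
     disjoint_family_on (\<lambda>(u, v). {u<..<v}) S"

text \<open>Signed increments: a family may skip the stretches where \<open>h\<close> decreases, so
  the supremum over all families is the positive variation and not the total one.\<close>

definition increments :: "(real \<Rightarrow> real) \<Rightarrow> (real \<times> real) set \<Rightarrow> real" where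
  "increments h S = (\<Sum>(u, v)\<in>S. h v - h u)"

text \<open>A junk value when the increments are unbounded above; on absolutely continuous functions
  they are bounded.\<close>

definition pos_variation :: "(real \<Rightarrow> real) \<Rightarrow> real \<Rightarrow> real \<Rightarrow> real" where
  "pos_variation h x y = (SUP S\<in>{S. intervals_in x y S}. increments h S)"

lemma intervals_in_finite: "intervals_in x y S \<Longrightarrow> finite S"
  by (simp add: intervals_in_def)

lemma intervals_in_bounds: "intervals_in x y S \<Longrightarrow> (u, v) \<in> S \<Longrightarrow> x \<le> u \<and> u < v \<and> v \<le> y"
  by (auto simp: intervals_in_def)

text \<open>Pointwise form of disjointness: a point of a truncated or refined interval also lies in
  its parent, so disjointness of derived families is read off from a common point.\<close>

lemma intervals_in_disjoint:
  "intervals_in x y S \<Longrightarrow> (u, v) \<in> S \<Longrightarrow> (u', v') \<in> S \<Longrightarrow> u < t \<Longrightarrow> t < v \<Longrightarrow> u' < t \<Longrightarrow> t < v'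
     \<Longrightarrow> u' = u \<and> v' = v"
  unfolding intervals_in_def disjoint_family_on_def by fastforce

lemma intervals_inI:
  assumes "finite S" "\<And>u v. (u, v) \<in> S \<Longrightarrow> x \<le> u \<and> u < v \<and> v \<le> y"
    and "\<And>u v u' v' t. (u, v) \<in> S \<Longrightarrow> (u', v') \<in> S \<Longrightarrow> u < t \<Longrightarrow> t < v \<Longrightarrow> u' < t \<Longrightarrow> t < v' \<Longrightarrow> u' = u \<and> v' = v"
  shows "intervals_in x y S"
proof -
  have "disjoint_family_on (\<lambda>(u, v). {u<..<v}) S"
    unfolding disjoint_family_on_def
  proof (intro ballI impI)
    fix p q assume pq: "p \<in> S" "q \<in> S" "p \<noteq> q"
    show "(case p of (u, v) \<Rightarrow> {u<..<v}) \<inter> (case q of (u, v) \<Rightarrow> {u<..<v}) = {}"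
      using assms(3)[of "fst p" "snd p" "fst q" "snd q"] pq by (auto simp: prod_eq_iff)
  qed
  with assms(1,2) show ?thesis by (auto simp: intervals_in_def)
qed

lemma intervals_in_empty: "intervals_in x y {}"
  by (rule intervals_inI) auto

lemma intervals_in_single: "u < v \<Longrightarrow> x \<le> u \<Longrightarrow> v \<le> y \<Longrightarrow> intervals_in x y {(u, v)}"
  by (rule intervals_inI) auto

lemma intervals_in_trivial:
  assumes S: "intervals_in x y S" and "y \<le> x"
  shows "S = {}"
proof (rule equals0I)
  fix p assume "p \<in> S"
  then show False using intervals_in_bounds[OF S, of "fst p" "snd p"] \<open>y \<le> x\<close> by simp
qed

lemma increments_empty [simp]: "increments h {} = 0"
  by (simp add: increments_def)

lemma intervals_in_mono: "intervals_in x y S \<Longrightarrow> x' \<le> x \<Longrightarrow> y \<le> y' \<Longrightarrow> intervals_in x' y' S"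
  by (force simp: intervals_in_def)

text \<open>Total length as the measure of a union lets monotonicity of the measure bound it, both
  inside an interval and inside a cover of a null set.\<close>

lemma intervals_in_measure:
  assumes S: "intervals_in x y S"
  shows "(\<Sum>(u, v)\<in>S. v - u) = measure lborel (\<Union>p\<in>S. {fst p<..<snd p})"
proof -
  have le: "fst p \<le> snd p" if "p \<in> S" for p
    using intervals_in_bounds[OF S, of "fst p" "snd p"] that by simp
  have "(\<Sum>(u, v)\<in>S. v - u) = (\<Sum>p\<in>S. measure lborel {fst p<..<snd p})"
    using le by (intro sum.cong) (simp_all add: case_prod_unfold)
  also have "\<dots> = measure lborel (\<Union>p\<in>S. {fst p<..<snd p})"
  proof (rule measure_finite_Union[symmetric])
    show "disjoint_family_on (\<lambda>p. {fst p<..<snd p}) S"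
      using S by (simp add: intervals_in_def case_prod_unfold)
  qed (use intervals_in_finite[OF S] le in auto)
  finally show ?thesis .
qed

lemma intervals_in_total_length:
  assumes S: "intervals_in x y S" and xy: "x \<le> y"
  shows "(\<Sum>(u, v)\<in>S. v - u) \<le> y - x"
proof -
  have "measure lborel (\<Union>p\<in>S. {fst p<..<snd p}) \<le> measure lborel {x..y}"
  proof (rule measure_mono_fmeasurable)
    show "(\<Union>p\<in>S. {fst p<..<snd p}) \<subseteq> {x..y}"
    proof
      fix t assume "t \<in> (\<Union>p\<in>S. {fst p<..<snd p})"
      then obtain p where "p \<in> S" "fst p < t" "t < snd p" by auto
      then show "t \<in> {x..y}" using intervals_in_bounds[OF S, of "fst p" "snd p"] by simp
    qed
    show "{x..y} \<in> fmeasurable lborel" by (rule fmeasurableI) (use xy in auto)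
  qed (use intervals_in_finite[OF S] in auto)
  then show ?thesis using xy by (simp add: intervals_in_measure[OF S])
qed

text \<open>An interval that straddles \<open>y\<close> is truncated on both sides; its increment
  splits by inserting \<open>h y\<close>.\<close>

lemma intervals_in_split:
  assumes S: "intervals_in x z S" and xyz: "x \<le> y" "y \<le> z"
  obtains S1 S2 where "intervals_in x y S1" "intervals_in y z S2"
    "increments h S = increments h S1 + increments h S2"
proof -
  define A where "A = {p\<in>S. fst p < y}"
  define B where "B = {p\<in>S. y < snd p}"
  define S1 where "S1 = (\<lambda>p. (fst p, min (snd p) y)) ` A"
  define S2 where "S2 = (\<lambda>p. (max (fst p) y, snd p)) ` B"
  note bd = intervals_in_bounds[OF S] and dj = intervals_in_disjoint[OF S]
  have fin: "finite S" "finite A" "finite B"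
    using intervals_in_finite[OF S] by (auto simp: A_def B_def)
  have i1: "intervals_in x y S1"
  proof (rule intervals_inI)
    fix u v u' v' t
    assume *: "(u, v) \<in> S1" "(u', v') \<in> S1" "u < t" "t < v" "u' < t" "t < v'"
    obtain w w' where "(u, w) \<in> S" "v = min w y" "(u', w') \<in> S" "v' = min w' y"
      using * by (auto simp: S1_def A_def)
    then show "u' = u \<and> v' = v" using dj[of u w u' w' t] * by auto
  qed (use bd xyz fin in \<open>auto simp: S1_def A_def\<close>)
  have i2: "intervals_in y z S2"
  proof (rule intervals_inI)
    fix u v u' v' t
    assume *: "(u, v) \<in> S2" "(u', v') \<in> S2" "u < t" "t < v" "u' < t" "t < v'"
    obtain w w' where "(w, v) \<in> S" "u = max w y" "(w', v') \<in> S" "u' = max w' y"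
      using * by (auto simp: S2_def B_def)
    then show "u' = u \<and> v' = v" using dj[of w v w' v' t] * by auto
  qed (use bd xyz fin in \<open>auto simp: S2_def B_def\<close>)
  \<comment> \<open>Truncated pieces are nonempty. If two of them coincide, their midpoint lies in
    both original intervals, which are therefore equal.\<close>
  have inj1: "inj_on (\<lambda>p. (fst p, min (snd p) y)) A"
  proof (rule inj_onI)
    fix p q assume *: "p \<in> A" "q \<in> A" "(fst p, min (snd p) y) = (fst q, min (snd q) y)"
    then have "fst p < (fst p + min (snd p) y) / 2" "(fst p + min (snd p) y) / 2 < snd p"
      "fst q < (fst p + min (snd p) y) / 2" "(fst p + min (snd p) y) / 2 < snd q"
      using bd[of "fst p" "snd p"] bd[of "fst q" "snd q"] by (auto simp: A_def min_def split: if_splits)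
    moreover have "(fst p, snd p) \<in> S" "(fst q, snd q) \<in> S" using *(1,2) by (auto simp: A_def)
    ultimately show "p = q"
      using dj[of "fst p" "snd p" "fst q" "snd q"] by (metis prod_eqI)
  qed
  have inj2: "inj_on (\<lambda>p. (max (fst p) y, snd p)) B"
  proof (rule inj_onI)
    fix p q assume *: "p \<in> B" "q \<in> B" "(max (fst p) y, snd p) = (max (fst q) y, snd q)"
    then have "fst p < (snd p + max (fst p) y) / 2" "(snd p + max (fst p) y) / 2 < snd p"
      "fst q < (snd p + max (fst p) y) / 2" "(snd p + max (fst p) y) / 2 < snd q"
      using bd[of "fst p" "snd p"] bd[of "fst q" "snd q"] by (auto simp: B_def max_def split: if_splits)
    moreover have "(fst p, snd p) \<in> S" "(fst q, snd q) \<in> S" using *(1,2) by (auto simp: B_def)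
    ultimately show "p = q"
      using dj[of "fst p" "snd p" "fst q" "snd q"] by (metis prod_eqI)
  qed
  have "increments h S = (\<Sum>p\<in>S. (if fst p < y then h (min (snd p) y) - h (fst p) else 0)
      + (if y < snd p then h (snd p) - h (max (fst p) y) else 0))"
    unfolding increments_def
  proof (intro sum.cong refl)
    fix p assume "p \<in> S"
    then show "(case p of (u, v) \<Rightarrow> h v - h u) =
      (if fst p < y then h (min (snd p) y) - h (fst p) else 0) + (if y < snd p then h (snd p) - h (max (fst p) y) else 0)"
      using bd[of "fst p" "snd p"] by (auto simp: case_prod_unfold min_def max_def)
  qed
  also have "\<dots> = (\<Sum>p\<in>A. h (min (snd p) y) - h (fst p)) + (\<Sum>p\<in>B. h (snd p) - h (max (fst p) y))"
    using fin by (simp add: sum.distrib A_def B_def sum.inter_filter)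
  also have "\<dots> = increments h S1 + increments h S2"
    using inj1 inj2 by (simp add: increments_def S1_def S2_def sum.reindex)
  finally show ?thesis using i1 i2 that by blast
qed

section \<open>Bounded variation and the positive variation of absolutely continuous
  functions\<close>

lemma abs_cont_on_small:
  assumes "abs_cont_on a b h" "\<epsilon> > 0"
  obtains \<delta> where "\<delta> > 0"
    "\<And>S. intervals_in a b S \<Longrightarrow> (\<Sum>(u, v)\<in>S. v - u) < \<delta> \<Longrightarrow> (\<Sum>(u, v)\<in>S. \<bar>h v - h u\<bar>) < \<epsilon>"
proof -
  obtain \<delta> where "\<delta> > 0" "\<forall>P. finite P \<and> (\<forall>(u, v)\<in>P. a \<le> u \<and> u < v \<and> v \<le> b) \<and>
      disjoint_family_on (\<lambda>(u, v). {u<..<v}) P \<and> (\<Sum>(u, v)\<in>P. v - u) < \<delta> \<longrightarrow>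
      (\<Sum>(u, v)\<in>P. \<bar>h v - h u\<bar>) < \<epsilon>"
    using assms unfolding abs_cont_on_def by blast
  then show ?thesis using that unfolding intervals_in_def by blast
qed

lemma increments_le_abs: "increments h S \<le> (\<Sum>(u, v)\<in>S. \<bar>h v - h u\<bar>)"
  unfolding increments_def by (intro sum_mono) auto

text \<open>Take \<open>\<delta>\<close> for the tolerance 1. A family is cut into consecutive
  blocks of length at most \<open>\<delta> / 2\<close>, each contributing less than 1; halving makes
  the required length bound strict.\<close>

lemma abs_cont_on_increments_bounded:
  assumes ac: "abs_cont_on a b h" and xy: "a \<le> x" "y \<le> b"
  shows "bdd_above (increments h ` {S. intervals_in x y S})"
proof -
  obtain \<delta> where \<delta>: "\<delta> > 0"
    "\<And>S. intervals_in a b S \<Longrightarrow> (\<Sum>(u, v)\<in>S. v - u) < \<delta> \<Longrightarrow> (\<Sum>(u, v)\<in>S. \<bar>h v - h u\<bar>) < 1"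
    using abs_cont_on_small[OF ac, of 1] by auto
  have main: "\<exists>B. \<forall>S. intervals_in a y S \<longrightarrow> increments h S \<le> B"
    if "a \<le> y" "y \<le> b" "y \<le> a + real n * (\<delta> / 2)" for n y
    using that
  proof (induction n arbitrary: y)
    case 0
    then have "increments h S \<le> 0" if "intervals_in a y S" for S
      using intervals_in_trivial[OF that] by simp
    then show ?case by blast
  next
    case (Suc n)
    define z where "z = max a (y - \<delta> / 2)"
    have z: "a \<le> z" "z \<le> y" "z \<le> b" "z \<le> a + real n * (\<delta> / 2)" "y - z < \<delta>"
      using Suc.prems \<delta>(1) by (auto simp: z_def algebra_simps add_divide_distrib)
    obtain B where B: "\<forall>S. intervals_in a z S \<longrightarrow> increments h S \<le> B"
      using Suc.IH[of z] z by auto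
    have "increments h S \<le> B + 1" if S: "intervals_in a y S" for S
    proof -
      obtain S1 S2 where S12: "intervals_in a z S1" "intervals_in z y S2"
        "increments h S = increments h S1 + increments h S2"
        using intervals_in_split[OF S z(1,2)] by metis
      have "(\<Sum>(u, v)\<in>S2. \<bar>h v - h u\<bar>) < 1"
      proof (rule \<delta>(2))
        show "intervals_in a b S2" using intervals_in_mono[OF S12(2)] z Suc.prems by blast
        show "(\<Sum>(u, v)\<in>S2. v - u) < \<delta>"
          using intervals_in_total_length[OF S12(2) z(2)] z(5) by linarith
      qed
      moreover have "increments h S1 \<le> B" using B S12(1) by blast
      ultimately show ?thesis unfolding S12(3) using increments_le_abs[of h S2] by linarith
    qed
    then show ?case by blast
  qed
  show ?thesis
  proof (cases "a \<le> b")
    case True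
    obtain n where "(b - a) / (\<delta> / 2) \<le> real n" using real_arch_simple by blast
    then have "b \<le> a + real n * (\<delta> / 2)" using \<delta>(1) by (simp add: field_simps)
    then obtain B where "\<forall>S. intervals_in a b S \<longrightarrow> increments h S \<le> B" using main[of b n] True by auto
    then have "increments h S \<le> B" if "intervals_in x y S" for S
      using intervals_in_mono[OF that xy] by blast
    then show ?thesis by (intro bdd_aboveI[of _ B]) auto
  next
    case False
    then have "increments h S \<le> 0" if "intervals_in x y S" for S
      using intervals_in_trivial[OF that] xy by simp
    then show ?thesis by (intro bdd_aboveI[of _ 0]) auto
  qed
qed

lemma increments_le_pos_variation:
  assumes "abs_cont_on a b h" "a \<le> x" "y \<le> b" "intervals_in x y S"
  shows "increments h S \<le> pos_variation h x y"
  unfolding pos_variation_def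
  using abs_cont_on_increments_bounded[OF assms(1-3)] assms(4) by (intro cSUP_upper) auto

lemma pos_variation_le:
  assumes "\<And>S. intervals_in x y S \<Longrightarrow> increments h S \<le> c"
  shows "pos_variation h x y \<le> c"
  unfolding pos_variation_def using intervals_in_empty[of x y] assms
  by (intro cSUP_least) auto

lemma pos_variation_mono:
  assumes "abs_cont_on a b h" "a \<le> x" "x \<le> y" "y \<le> b"
  shows "pos_variation h a x \<le> pos_variation h a y"
  using assms by (intro pos_variation_le increments_le_pos_variation[where a=a and b=b])
    (auto intro: intervals_in_mono)

text \<open>The interval \<open>(x, y)\<close> can be appended to any family on
  \<open>{a..x}\<close>. Consequently the positive variation minus \<open>h\<close> is increasing,
  which is the second half of the decomposition.\<close>

lemma pos_variation_ge_increment: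
  assumes ac: "abs_cont_on a b h" and "a \<le> x" "x \<le> y" "y \<le> b"
  shows "pos_variation h a x + (h y - h x) \<le> pos_variation h a y"
proof (cases "x = y")
  case False
  then have "x < y" using assms by simp
  have "increments h S \<le> pos_variation h a y - (h y - h x)" if S: "intervals_in a x S" for S
  proof -
    note bd = intervals_in_bounds[OF S]
    have n: "(x, y) \<notin> S" using bd[of x y] \<open>x < y\<close> by auto
    have "intervals_in a y (insert (x, y) S)"
    proof (rule intervals_inI)
      show "finite (insert (x, y) S)" using intervals_in_finite[OF S] by simp
    next
      fix u v assume "(u, v) \<in> insert (x, y) S"
      then show "a \<le> u \<and> u < v \<and> v \<le> y" using bd[of u v] assms \<open>x < y\<close> by auto
    next
      fix u v u' v' t
      assume "(u, v) \<in> insert (x, y) S" "(u', v') \<in> insert (x, y) S" "u < t" "t < v" "u' < t" "t < v'"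
      then show "u' = u \<and> v' = v"
        using bd[of u v] bd[of u' v'] intervals_in_disjoint[OF S, of u v u' v' t] by auto
    qed
    from increments_le_pos_variation[OF ac order_refl _ this] assms n intervals_in_finite[OF S]
    show ?thesis by (simp add: increments_def)
  qed
  then have "pos_variation h a x \<le> pos_variation h a y - (h y - h x)" by (rule pos_variation_le)
  then show ?thesis by simp
qed simp

text \<open>A family on \<open>{a..y}\<close> is cut at \<open>x\<close>. The change of the positive
  variation over an interval is thus bounded by the positive variation of \<open>h\<close> inside
  it.\<close>

lemma pos_variation_subadd:
  assumes ac: "abs_cont_on a b h" and "a \<le> x" "x \<le> y" "y \<le> b"
  shows "pos_variation h a y \<le> pos_variation h a x + pos_variation h x y"
proof (rule pos_variation_le)
  fix S assume S: "intervals_in a y S"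
  obtain S1 S2 where S12: "intervals_in a x S1" "intervals_in x y S2"
    "increments h S = increments h S1 + increments h S2"
    using intervals_in_split[OF S assms(2,3)] by metis
  show "increments h S \<le> pos_variation h a x + pos_variation h x y"
    unfolding S12(3) using assms S12(1,2)
    by (intro add_mono increments_le_pos_variation[where a=a and b=b]) auto
qed

text \<open>A common point of two small intervals lies in both parents, so the parents agree. The
  second claim lets a sum over the refined family split along \<open>S\<close>.\<close>

lemma intervals_in_UN:
  assumes S: "intervals_in a b S" and T: "\<And>u v. (u, v) \<in> S \<Longrightarrow> intervals_in u v (T (u, v))"
  shows "intervals_in a b (\<Union>(T ` S))" and "disjoint_family_on T S"
proof -
  note bd = intervals_in_bounds[OF S] and dj = intervals_in_disjoint[OF S]
  have Tb: "fst p \<le> u \<and> u < v \<and> v \<le> snd p" if "p \<in> S" "(u, v) \<in> T p" for p u v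
    using intervals_in_bounds[OF T[of "fst p" "snd p"], of u v] that by auto
  have same: "p = q" if *: "p \<in> S" "q \<in> S" "(u, v) \<in> T p" "(u', v') \<in> T q"
    "u < t" "t < v" "u' < t" "t < v'" for p q u v u' v' t
  proof -
    have "fst q = fst p \<and> snd q = snd p"
      using dj[of "fst p" "snd p" "fst q" "snd q" t] Tb[OF *(1,3)] Tb[OF *(2,4)] * by auto
    then show ?thesis by (simp add: prod_eq_iff)
  qed
  show "intervals_in a b (\<Union>(T ` S))"
  proof (rule intervals_inI)
    have "finite (T p)" if "p \<in> S" for p
      using intervals_in_finite[OF T[of "fst p" "snd p"]] that by simp
    then show "finite (\<Union>(T ` S))" using intervals_in_finite[OF S] by blast
  next
    fix u v assume "(u, v) \<in> \<Union>(T ` S)"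
    then obtain p where p: "p \<in> S" "(u, v) \<in> T p" by auto
    show "a \<le> u \<and> u < v \<and> v \<le> b" using Tb[OF p] bd[of "fst p" "snd p"] p by auto
  next
    fix u v u' v' t
    assume *: "(u, v) \<in> \<Union>(T ` S)" "(u', v') \<in> \<Union>(T ` S)" "u < t" "t < v" "u' < t" "t < v'"
    then obtain p q where pq: "p \<in> S" "(u, v) \<in> T p" "q \<in> S" "(u', v') \<in> T q" by auto
    with same * have "p = q" by blast
    then show "u' = u \<and> v' = v"
      using intervals_in_disjoint[OF T[of "fst p" "snd p"], of u v u' v' t] pq * by auto
  qed
  show "disjoint_family_on T S"
    unfolding disjoint_family_on_def
  proof (intro ballI impI, rule ccontr)
    fix p q assume *: "p \<in> S" "q \<in> S" "p \<noteq> q" "T p \<inter> T q \<noteq> {}"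
    then obtain u v where uv: "(u, v) \<in> T p" "(u, v) \<in> T q" by auto
    then have "u < v" using Tb * by blast
    then show False using same[OF *(1,2) uv, of "(u + v) / 2"] * by auto
  qed
qed

text \<open>Inside each interval choose a family whose increments nearly attain the positive
  variation there. The refined family has no larger total length, so the condition on
  \<open>h\<close> applies to it.\<close>

lemma abs_cont_on_pos_variation:
  assumes ac: "abs_cont_on a b h"
  shows "abs_cont_on a b (pos_variation h a)"
  unfolding abs_cont_on_def
proof (intro allI impI)
  fix \<epsilon> :: real assume \<epsilon>: "\<epsilon> > 0"
  obtain \<delta> where \<delta>: "\<delta> > 0"
    "\<And>S. intervals_in a b S \<Longrightarrow> (\<Sum>(u, v)\<in>S. v - u) < \<delta> \<Longrightarrow> (\<Sum>(u, v)\<in>S. \<bar>h v - h u\<bar>) < \<epsilon> / 2"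
    using abs_cont_on_small[OF ac, of "\<epsilon> / 2"] \<epsilon> by auto
  have "(\<Sum>(u, v)\<in>S. \<bar>pos_variation h a v - pos_variation h a u\<bar>) < \<epsilon>"
    if S: "intervals_in a b S" and len: "(\<Sum>(u, v)\<in>S. v - u) < \<delta>" for S
  proof -
    note bd = intervals_in_bounds[OF S] and fin = intervals_in_finite[OF S]
    \<comment> \<open>The errors add up to \<open>real (card S) * \<eta>\<close>, at most half of
      \<open>\<epsilon>\<close>; the added 1 covers the empty family.\<close>
    define \<eta> where "\<eta> = \<epsilon> / (2 * (real (card S) + 1))"
    have \<eta>: "\<eta> > 0" using \<epsilon> by (simp add: \<eta>_def)
    have "\<exists>T. intervals_in (fst p) (snd p) T \<and> pos_variation h (fst p) (snd p) < increments h T + \<eta>" for p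
    proof (rule ccontr)
      assume "\<not> ?thesis"
      then have "increments h T \<le> pos_variation h (fst p) (snd p) - \<eta>"
        if "intervals_in (fst p) (snd p) T" for T using that by force
      then have "pos_variation h (fst p) (snd p) \<le> pos_variation h (fst p) (snd p) - \<eta>"
        by (rule pos_variation_le)
      with \<eta> show False by simp
    qed
    then obtain T where T: "\<And>p. intervals_in (fst p) (snd p) (T p)"
      "\<And>p. pos_variation h (fst p) (snd p) < increments h (T p) + \<eta>" by metis
    have T': "intervals_in u v (T (u, v))" for u v using T(1)[of "(u, v)"] by simp
    have finT: "finite (T p)" for p using intervals_in_finite[OF T(1)] .
    note U = intervals_in_UN[OF S T']
    have inj: "\<forall>p\<in>S. \<forall>q\<in>S. p \<noteq> q \<longrightarrow> T p \<inter> T q = {}"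
      using U(2) by (auto simp: disjoint_family_on_def)
    have "(\<Sum>(u, v)\<in>\<Union>(T ` S). v - u) = (\<Sum>p\<in>S. \<Sum>(u, v)\<in>T p. v - u)"
      using fin finT inj by (intro sum.UNION_disjoint) auto
    also have "\<dots> \<le> (\<Sum>p\<in>S. snd p - fst p)"
      using bd by (intro sum_mono intervals_in_total_length T(1)) force
    also have "\<dots> < \<delta>" using len by (simp add: case_prod_unfold)
    finally have "(\<Sum>(u, v)\<in>\<Union>(T ` S). \<bar>h v - h u\<bar>) < \<epsilon> / 2" using \<delta>(2)[OF U(1)] by blast
    then have small: "increments h (\<Union>(T ` S)) < \<epsilon> / 2" using increments_le_abs[of h "\<Union>(T ` S)"] by simp
    have "(\<Sum>(u, v)\<in>S. \<bar>pos_variation h a v - pos_variation h a u\<bar>) \<le> (\<Sum>p\<in>S. increments h (T p) + \<eta>)"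
      unfolding case_prod_unfold
    proof (rule sum_mono)
      fix p assume "p \<in> S"
      then have b: "a \<le> fst p" "fst p \<le> snd p" "snd p \<le> b" using bd[of "fst p" "snd p"] by auto
      show "\<bar>pos_variation h a (snd p) - pos_variation h a (fst p)\<bar> \<le> increments h (T p) + \<eta>"
        using pos_variation_mono[OF ac b] pos_variation_subadd[OF ac b] T(2)[of p] by simp
    qed
    also have "\<dots> = increments h (\<Union>(T ` S)) + real (card S) * \<eta>"
      unfolding increments_def
      using fin finT inj by (simp add: sum.distrib sum.UNION_disjoint)
    also have "real (card S) * \<eta> \<le> \<epsilon> / 2"
      using \<epsilon> by (simp add: \<eta>_def field_simps)
    finally show ?thesis using small by linarith
  qed
  then show "\<exists>\<delta>>0. \<forall>P. finite P \<and> (\<forall>(u, v)\<in>P. a \<le> u \<and> u < v \<and> v \<le> b) \<and>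
      disjoint_family_on (\<lambda>(u, v). {u<..<v}) P \<and> (\<Sum>(u, v)\<in>P. v - u) < \<delta> \<longrightarrow>
      (\<Sum>(u, v)\<in>P. \<bar>pos_variation h a v - pos_variation h a u\<bar>) < \<epsilon>"
    using \<delta>(1) unfolding intervals_in_def by blast
qed

lemma abs_cont_on_diff:
  assumes "abs_cont_on a b g" "abs_cont_on a b h"
  shows "abs_cont_on a b (\<lambda>x. g x - h x)"
  unfolding abs_cont_on_def
proof (intro allI impI)
  fix \<epsilon> :: real assume "\<epsilon> > 0"
  then have \<epsilon>: "\<epsilon> / 2 > 0" by simp
  obtain d1 where d1: "d1 > 0"
    "\<And>S. intervals_in a b S \<Longrightarrow> (\<Sum>(u, v)\<in>S. v - u) < d1 \<Longrightarrow> (\<Sum>(u, v)\<in>S. \<bar>g v - g u\<bar>) < \<epsilon> / 2"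
    using abs_cont_on_small[OF assms(1) \<epsilon>] by metis
  obtain d2 where d2: "d2 > 0"
    "\<And>S. intervals_in a b S \<Longrightarrow> (\<Sum>(u, v)\<in>S. v - u) < d2 \<Longrightarrow> (\<Sum>(u, v)\<in>S. \<bar>h v - h u\<bar>) < \<epsilon> / 2"
    using abs_cont_on_small[OF assms(2) \<epsilon>] by metis
  have "(\<Sum>(u, v)\<in>S. \<bar>g v - h v - (g u - h u)\<bar>) < \<epsilon>"
    if S: "intervals_in a b S" and len: "(\<Sum>(u, v)\<in>S. v - u) < min d1 d2" for S
  proof -
    have "(\<Sum>(u, v)\<in>S. \<bar>g v - h v - (g u - h u)\<bar>) \<le> (\<Sum>(u, v)\<in>S. \<bar>g v - g u\<bar>) + (\<Sum>(u, v)\<in>S. \<bar>h v - h u\<bar>)"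
      unfolding sum.distrib[symmetric] case_prod_unfold by (intro sum_mono) auto
    then show ?thesis using d1(2)[OF S] d2(2)[OF S] len by auto
  qed
  then show "\<exists>\<delta>>0. \<forall>P. finite P \<and> (\<forall>(u, v)\<in>P. a \<le> u \<and> u < v \<and> v \<le> b) \<and>
      disjoint_family_on (\<lambda>(u, v). {u<..<v}) P \<and> (\<Sum>(u, v)\<in>P. v - u) < \<delta> \<longrightarrow>
      (\<Sum>(u, v)\<in>P. \<bar>g v - h v - (g u - h u)\<bar>) < \<epsilon>"
    using d1(1) d2(1) unfolding intervals_in_def by (intro exI[of _ "min d1 d2"]) auto
qed

lemma abs_cont_on_continuous_on:
  assumes ac: "abs_cont_on a b h"
  shows "continuous_on {a..b} h"
  unfolding continuous_on_iff
proof (intro ballI allI impI)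
  fix x e :: real assume x: "x \<in> {a..b}" and e: "e > 0"
  obtain d where d: "d > 0"
    "\<And>S. intervals_in a b S \<Longrightarrow> (\<Sum>(u, v)\<in>S. v - u) < d \<Longrightarrow> (\<Sum>(u, v)\<in>S. \<bar>h v - h u\<bar>) < e"
    using abs_cont_on_small[OF ac e] by metis
  have "dist (h y) (h x) < e" if y: "y \<in> {a..b}" "dist y x < d" for y
  proof -
    consider "y < x" | "y = x" | "x < y" by linarith
    then show ?thesis
    proof cases
      case 1
      then show ?thesis using d(2)[OF intervals_in_single[of y x]] x y by (auto simp: dist_real_def)
    next
      case 3
      then show ?thesis using d(2)[OF intervals_in_single[of x y]] x y by (auto simp: dist_real_def)
    qed (use e in auto)
  qed
  then show "\<exists>d>0. \<forall>x'\<in>{a..b}. dist x' x < d \<longrightarrow> dist (h x') (h x) < e" using d(1) by auto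
qed

section \<open>Stieltjes measures and densities of monotone absolutely continuous functions\<close>

text \<open>
  A null set is covered by countably many nonoverlapping intervals of small total length; absolute
  continuity makes the increments of \<open>g\<close> over finitely many of them small.
\<close>

lemma abs_cont_on_mono_null_set:
  assumes ab: "a < b" and ac: "abs_cont_on a b g"
    and mono: "mono G" and cont: "continuous_on UNIV G"
    and G: "\<And>x. x \<in> {a..b} \<Longrightarrow> G x = g x"
    and A: "A \<in> null_sets lborel" "A \<subseteq> {a..b}"
  shows "emeasure (interval_measure G) A = 0"
proof -
  let ?N = "interval_measure G"
  have N: "emeasure ?N {x..y} = ennreal (G y - G x)" if "x \<le> y" for x y
    using emeasure_interval_measure_Icc[OF that monoD[OF mono] cont] by simp
  have "emeasure ?N A \<le> ennreal \<epsilon>" if eps: "\<epsilon> > 0" for \<epsilon> :: real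
  proof -
    obtain \<delta> where \<delta>: "\<delta> > 0"
      "\<And>S. intervals_in a b S \<Longrightarrow> (\<Sum>(u, v)\<in>S. v - u) < \<delta> \<Longrightarrow> (\<Sum>(u, v)\<in>S. \<bar>g v - g u\<bar>) < \<epsilon>"
      using abs_cont_on_small[OF ac eps] by metis
    have A': "A \<in> lmeasurable" "measure lebesgue A = 0"
      using A(1) null_sets_completionI[OF A(1)]
      by (auto intro: fmeasurableI_null_sets simp: measure_eq_0_null_sets)
    obtain \<D> where D: "countable \<D>"
        "\<And>K. K \<in> \<D> \<Longrightarrow> K \<subseteq> cbox a b \<and> K \<noteq> {} \<and> (\<exists>c d. K = cbox c d)"
        "pairwise (\<lambda>A B. interior A \<inter> interior B = {}) \<D>"
        "\<And>u v. cbox u v \<in> \<D> \<Longrightarrow> \<exists>n. \<forall>i \<in> Basis. v \<bullet> i - u \<bullet> i = (b \<bullet> i - a \<bullet> i)/2^n"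
        "\<And>K. \<lbrakk>K \<in> \<D>; box a b \<noteq> {}\<rbrakk> \<Longrightarrow> interior K \<noteq> {}"
        "A \<subseteq> \<Union>\<D>" "\<Union>\<D> \<in> lmeasurable" "measure lebesgue (\<Union>\<D>) \<le> measure lebesgue A + \<delta> / 2"
    proof (rule measurable_outer_intervals_bounded[OF A'(1), of a b "\<delta> / 2"])
      show "A \<subseteq> cbox a b" "\<delta> / 2 > 0" using A(2) \<delta>(1) by simp_all
    qed (rule that)
    define p where "p K = (Inf K, Sup K)" for K :: "real set"
    have K: "K = {fst (p K)..snd (p K)} \<and> a \<le> fst (p K) \<and> fst (p K) < snd (p K) \<and> snd (p K) \<le> b"
      if KD: "K \<in> \<D>" for K
    proof -
      obtain c d where cd: "K = {c..d}" using D(2)[OF KD] by (metis interval_cbox)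
      have "box a b \<noteq> {}" using ab by simp
      then have "interior K \<noteq> {}" by (rule D(5)[OF KD])
      then have "c < d" using cd by simp
      moreover have "{c..d} \<subseteq> {a..b}" using D(2)[OF KD] cd by (metis interval_cbox)
      ultimately show ?thesis by (simp add: p_def cd)
    qed
    have Kb: "K \<in> sets borel" if "K \<in> \<D>" for K
      by (subst conjunct1[OF K[OF that]]) simp
    have fin: "emeasure ?N (\<Union>F) \<le> ennreal \<epsilon>" if F: "finite F" "F \<subseteq> \<D>" for F
    proof -
      have inj: "inj_on p F"
      proof (rule inj_onI)
        fix L L' assume *: "L \<in> F" "L' \<in> F" "p L = p L'"
        have "L = {fst (p L)..snd (p L)}" "L' = {fst (p L')..snd (p L')}" using K F * by blast+
        then show "L = L'" using *(3) by metis
      qed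
      have S: "intervals_in a b (p ` F)"
      proof (rule intervals_inI)
        show "a \<le> u \<and> u < v \<and> v \<le> b" if "(u, v) \<in> p ` F" for u v
        proof -
          from that obtain L where "L \<in> F" "p L = (u, v)" by auto
          then show ?thesis using K[of L] F by auto
        qed
        fix u v u' v' t
        assume *: "(u, v) \<in> p ` F" "(u', v') \<in> p ` F" "u < t" "t < v" "u' < t" "t < v'"
        obtain L L' where L: "L \<in> F" "p L = (u, v)" "L' \<in> F" "p L' = (u', v')"
          using *(1,2) by auto
        have LD: "L \<in> \<D>" "L' \<in> \<D>" using L F by auto
        have L': "L = {u..v}" "L' = {u'..v'}" using K[OF LD(1)] K[OF LD(2)] L(2,4) by simp_all
        have "t \<in> interior L \<inter> interior L'" using * L' by simp
        then have "L = L'" using D(3) LD unfolding pairwise_def by blast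
        then show "u' = u \<and> v' = v" using L by simp
      qed (use F in auto)
      have "(\<Sum>(u, v)\<in>p ` F. v - u) = measure lborel (\<Union>q\<in>p ` F. {fst q<..<snd q})"
        by (rule intervals_in_measure[OF S])
      also have "\<dots> = measure lebesgue (\<Union>q\<in>p ` F. {fst q<..<snd q})"
        using F by (intro measure_completion[symmetric]) auto
      also have "\<dots> \<le> measure lebesgue (\<Union>\<D>)"
      proof (rule measure_mono_fmeasurable)
        show "(\<Union>q\<in>p ` F. {fst q<..<snd q}) \<subseteq> \<Union>\<D>"
        proof
          fix t assume "t \<in> (\<Union>q\<in>p ` F. {fst q<..<snd q})"
          then obtain L where L: "L \<in> F" "fst (p L) < t" "t < snd (p L)" by auto
          then have "L \<in> \<D>" using F by auto
          then have "L = {fst (p L)..snd (p L)}" using K by blast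
          moreover have "t \<in> {fst (p L)..snd (p L)}" using L by simp
          ultimately have "t \<in> L" by (rule ssubst)
          then show "t \<in> \<Union>\<D>" using \<open>L \<in> \<D>\<close> by blast
        qed
      qed (use F D(7) in auto)
      also have "\<dots> < \<delta>" using D(8) A'(2) \<delta>(1) by simp
      finally have small: "(\<Sum>(u, v)\<in>p ` F. \<bar>g v - g u\<bar>) < \<epsilon>" by (rule \<delta>(2)[OF S])
      have "emeasure ?N (\<Union>F) \<le> (\<Sum>L\<in>F. emeasure ?N L)"
        using emeasure_subadditive_finite[of F "\<lambda>L. L" ?N] F Kb by (simp add: subset_iff)
      also have "\<dots> = (\<Sum>L\<in>F. ennreal \<bar>g (snd (p L)) - g (fst (p L))\<bar>)"
      proof (rule sum.cong[OF refl])
        fix L assume "L \<in> F"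
        then have L: "L = {fst (p L)..snd (p L)}" "a \<le> fst (p L)" "fst (p L) < snd (p L)" "snd (p L) \<le> b"
          using K[of L] F by blast+
        have "emeasure ?N L = ennreal (G (snd (p L)) - G (fst (p L)))"
          by (subst L(1), rule N) (use L(3) in simp)
        also have "G (snd (p L)) - G (fst (p L)) = \<bar>g (snd (p L)) - g (fst (p L))\<bar>"
          using monoD[OF mono, of "fst (p L)" "snd (p L)"] L(2-4) G by simp
        finally show "emeasure ?N L = ennreal \<bar>g (snd (p L)) - g (fst (p L))\<bar>" .
      qed
      also have "\<dots> = ennreal (\<Sum>(u, v)\<in>p ` F. \<bar>g v - g u\<bar>)"
        using inj by (simp add: sum.reindex case_prod_unfold)
      also have "\<dots> \<le> ennreal \<epsilon>" using small by (intro ennreal_leI) simp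
      finally show ?thesis .
    qed
    show ?thesis
    proof (cases "\<D> = {}")
      case True
      with D(6) have "A = {}" by simp
      then show ?thesis by simp
    next
      case False
      \<comment> \<open>Absolute continuity speaks of finite families only. The finite unions
        \<open>E n\<close> increase and exhaust the cover, and continuity from below carries the
        bound over; repetitions in the enumeration do no harm.\<close>
      define E where "E n = \<Union>(from_nat_into \<D> ` {..<n})" for n :: nat
      have Eb: "from_nat_into \<D> ` {..<n} \<subseteq> \<D>" for n using from_nat_into[OF False] by auto
      have EN: "E n \<in> sets ?N" for n
        unfolding E_def sets_interval_measure
      proof (rule sets.finite_UN)
        show "from_nat_into \<D> i \<in> sets borel" for i by (rule Kb[OF from_nat_into[OF False]])
      qed simp
      have "A \<subseteq> (\<Union>n. E n)"
      proof
        fix t assume "t \<in> A"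
        then obtain L where L: "L \<in> \<D>" "t \<in> L" using D(6) by blast
        then obtain n where "from_nat_into \<D> n = L" using from_nat_into_surj[OF D(1)] by blast
        moreover have "n \<in> {..<Suc n}" by simp
        ultimately have "t \<in> E (Suc n)" using L(2) unfolding E_def by (metis UN_I)
        then show "t \<in> (\<Union>n. E n)" by blast
      qed
      then have "emeasure ?N A \<le> emeasure ?N (\<Union>n. E n)"
        by (rule emeasure_mono) (rule sets.countable_UN, use EN in blast)
      also have "\<dots> = (SUP n. emeasure ?N (E n))"
      proof (rule SUP_emeasure_incseq[symmetric])
        show "range E \<subseteq> sets ?N" using EN by auto
        show "incseq E" unfolding E_def by (intro monoI Union_mono image_mono) simp
      qed
      also have "\<dots> \<le> ennreal \<epsilon>"
      proof (rule SUP_least)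
        show "emeasure ?N (E n) \<le> ennreal \<epsilon>" for n
          unfolding E_def by (rule fin[OF _ Eb]) simp
      qed
      finally show ?thesis .
    qed
  qed
  then have "emeasure ?N A \<le> 0 + ennreal \<epsilon>" if "\<epsilon> > 0" for \<epsilon> :: real
    using that by simp
  then have "emeasure ?N A \<le> 0"
    by (rule ennreal_le_epsilon)
  then show ?thesis by simp
qed

text \<open>The Stieltjes measure of \<open>g\<close> vanishes on Lebesgue null sets, so it has a
  Radon-Nikodym density, whose integral over \<open>{a..x}\<close> is the increment of
  \<open>g\<close>.\<close>

lemma abs_cont_on_mono_density:
  assumes ab: "a < b" and ac: "abs_cont_on a b g"
    and mono: "\<And>x y. a \<le> x \<Longrightarrow> x \<le> y \<Longrightarrow> y \<le> b \<Longrightarrow> g x \<le> g y"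
  obtains q where "integrable lborel q" "q \<in> borel_measurable borel" "\<And>x. x \<notin> {a..b} \<Longrightarrow> q x = 0"
    "\<And>x. x \<in> {a..b} \<Longrightarrow> g x = g a + (\<integral>t. indicator {a..x} t * q t \<partial>lborel)"
proof -
  \<comment> \<open>Freezing \<open>g\<close> outside \<open>{a..b}\<close> makes \<open>G\<close>
    monotone and continuous on the whole line and leaves its Stieltjes measure without mass outside
    the interval.\<close>
  define G where "G x = g (max a (min b x))" for x
  have cl: "max a (min b x) \<in> {a..b}" for x using ab by auto
  have mG: "mono G"
    unfolding G_def by (intro monoI mono) (use ab in auto)
  have cG: "continuous_on UNIV G"
    unfolding G_def by (rule continuous_on_compose2[OF abs_cont_on_continuous_on[OF ac]])
      (use cl in \<open>auto intro!: continuous_intros\<close>)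
  have Geq: "G x = g x" if "x \<in> {a..b}" for x using that by (auto simp: G_def)
  let ?N = "interval_measure G"
  have N: "emeasure ?N {x..y} = ennreal (G y - G x)" if "x \<le> y" for x y
    using emeasure_interval_measure_Icc[OF that monoD[OF mG] cG] by simp
  have ac': "absolutely_continuous lborel ?N"
    unfolding absolutely_continuous_def
  proof
    fix A :: "real set" assume A: "A \<in> null_sets lborel"
    have "{a - real n..a} \<in> null_sets ?N" for n
      using N[of "a - real n" a] ab by (intro null_setsI) (auto simp: G_def)
    moreover have "{b..b + real n} \<in> null_sets ?N" for n
      using N[of b "b + real n"] ab by (intro null_setsI) (auto simp: G_def max_def min_def)
    moreover have "A \<inter> {a..b} \<in> null_sets ?N"
    proof (rule null_setsI)
      show "emeasure ?N (A \<inter> {a..b}) = 0"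
        by (rule abs_cont_on_mono_null_set[OF ab ac mG cG Geq]) (use A in \<open>auto intro: null_set_Int2\<close>)
    qed (use A in auto)
    ultimately have nul: "(A \<inter> {a..b}) \<union> ((\<Union>n. {a - real n..a}) \<union> (\<Union>n. {b..b + real n})) \<in> null_sets ?N"
      by (intro null_sets.Un null_sets_UN) auto
    have sub: "A \<subseteq> (A \<inter> {a..b}) \<union> ((\<Union>n. {a - real n..a}) \<union> (\<Union>n. {b..b + real n}))"
    proof
      fix x assume "x \<in> A"
      obtain n where "\<bar>x - a\<bar> + \<bar>x - b\<bar> \<le> real n" using real_arch_simple by blast
      then have "a - real n \<le> x" "x \<le> b + real n" by linarith+
      then show "x \<in> (A \<inter> {a..b}) \<union> ((\<Union>n. {a - real n..a}) \<union> (\<Union>n. {b..b + real n}))"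
        using \<open>x \<in> A\<close> by (cases "x < a"; cases "b < x") auto
    qed
    show "A \<in> null_sets ?N"
      by (rule null_sets_subset[OF nul _ sub]) (use A in auto)
  qed
  obtain f where f: "f \<in> borel_measurable lborel" "density lborel f = ?N"
    using sigma_finite_measure.Radon_Nikodym[OF sigma_finite_lborel ac'] by auto
  have fI: "(\<integral>\<^sup>+t. f t * indicator {a..x} t \<partial>lborel) = ennreal (g x - g a)" if "x \<in> {a..b}" for x
  proof -
    have "(\<integral>\<^sup>+t. f t * indicator {a..x} t \<partial>lborel) = emeasure ?N {a..x}"
      using emeasure_density[OF f(1), of "{a..x}"] by (simp add: f(2))
    then show ?thesis using N[of a x] that Geq[of x] Geq[of a] by simp
  qed
  have fm[measurable]: "f \<in> borel_measurable borel" using f(1) by simp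
  \<comment> \<open>The density takes values in \<open>ennreal\<close>. Its integral over
    \<open>{a..b}\<close> is finite, so \<open>enn2real\<close> changes it there on a null set
    only.\<close>
  have "AE t in lborel. f t * indicator {a..b} t \<noteq> \<infinity>"
  proof (rule nn_integral_PInf_AE)
    show "(\<integral>\<^sup>+t. f t * indicator {a..b} t \<partial>lborel) \<noteq> \<infinity>"
      using fI[of b] ab by simp
  qed measurable
  then have fin: "AE t in lborel. t \<in> {a..b} \<longrightarrow> ennreal (enn2real (f t)) = f t"
  proof eventually_elim
    case (elim t)
    then show ?case by (cases "t \<in> {a..b}") (simp add: less_top, blast)
  qed
  define q where "q t = enn2real (f t) * indicator {a..b} t" for t
  have qm[measurable]: "q \<in> borel_measurable borel" unfolding q_def by measurable
  have qI: "has_bochner_integral lborel (\<lambda>t. indicator {a..x} t * q t) (g x - g a)" if x: "x \<in> {a..b}" for x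
  proof (rule has_bochner_integral_nn_integral)
    have "(\<integral>\<^sup>+t. ennreal (indicator {a..x} t * q t) \<partial>lborel) = (\<integral>\<^sup>+t. f t * indicator {a..x} t \<partial>lborel)"
    proof (rule nn_integral_cong_AE)
      show "AE t in lborel. ennreal (indicator {a..x} t * q t) = f t * indicator {a..x} t"
        using fin
      proof eventually_elim
        case (elim t)
        then show ?case using x by (cases "t \<in> {a..x}") (simp_all add: q_def)
      qed
    qed
    then show "(\<integral>\<^sup>+t. ennreal (indicator {a..x} t * q t) \<partial>lborel) = ennreal (g x - g a)"
      using fI[OF x] by simp
    show "0 \<le> g x - g a" using mono[of a x] x by simp
    show "AE t in lborel. 0 \<le> indicator {a..x} t * q t" by (simp add: q_def)
  qed measurable
  show ?thesis
  proof (rule that)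
    have "integrable lborel (\<lambda>t. indicator {a..b} t * q t)"
      using qI[of b] ab by (simp add: has_bochner_integral_iff)
    also have "(\<lambda>t. indicator {a..b} t * q t) = q" by (auto simp: q_def indicator_def)
    finally show "integrable lborel q" .
    show "q \<in> borel_measurable borel" by (rule qm)
    show "q x = 0" if "x \<notin> {a..b}" for x using that by (simp add: q_def)
    show "g x = g a + (\<integral>t. indicator {a..x} t * q t \<partial>lborel)" if "x \<in> {a..b}" for x
      using qI[OF that] by (simp add: has_bochner_integral_iff)
  qed
qed

text \<open>
  With \<open>P\<close> the positive variation, \<open>h = P - (P - h)\<close> is a difference of increasing absolutely
  continuous functions.
\<close>

theorem abs_cont_on_imp_indefinite_integral:
  assumes ab: "a < b" and ac: "abs_cont_on a b h"
  obtains q where "integrable lborel q" "q \<in> borel_measurable borel" "\<And>x. x \<notin> {a..b} \<Longrightarrow> q x = 0"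
    "\<And>x. x \<in> {a..b} \<Longrightarrow> h x = h a + (\<integral>t. indicator {a..x} t * q t \<partial>lborel)"
proof -
  let ?P = "pos_variation h a"
  have acP: "abs_cont_on a b ?P" by (rule abs_cont_on_pos_variation[OF ac])
  obtain q1 where q1: "integrable lborel q1" "q1 \<in> borel_measurable borel" "\<And>x. x \<notin> {a..b} \<Longrightarrow> q1 x = 0"
    "\<And>x. x \<in> {a..b} \<Longrightarrow> ?P x = ?P a + (\<integral>t. indicator {a..x} t * q1 t \<partial>lborel)"
  proof (rule abs_cont_on_mono_density[OF ab acP])
    show "?P x \<le> ?P y" if "a \<le> x" "x \<le> y" "y \<le> b" for x y
      using pos_variation_mono[OF ac that] .
  qed (rule that)
  obtain q2 where q2: "integrable lborel q2" "q2 \<in> borel_measurable borel" "\<And>x. x \<notin> {a..b} \<Longrightarrow> q2 x = 0"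
    "\<And>x. x \<in> {a..b} \<Longrightarrow> ?P x - h x = ?P a - h a + (\<integral>t. indicator {a..x} t * q2 t \<partial>lborel)"
  proof (rule abs_cont_on_mono_density[OF ab abs_cont_on_diff[OF acP ac]])
    show "?P x - h x \<le> ?P y - h y" if "a \<le> x" "x \<le> y" "y \<le> b" for x y
      using pos_variation_ge_increment[OF ac that] by simp
  qed (rule that)
  show ?thesis
  proof (rule that[of "\<lambda>t. q1 t - q2 t"])
    fix x assume x: "x \<in> {a..b}"
    have i: "integrable lborel (\<lambda>t. indicator {a..x} t * q1 t)" "integrable lborel (\<lambda>t. indicator {a..x} t * q2 t)"
      using q1(1) q2(1) integrable_real_mult_indicator[of "{a..x}" lborel q1]
        integrable_real_mult_indicator[of "{a..x}" lborel q2] by (simp_all add: mult.commute)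
    show "h x = h a + (\<integral>t. indicator {a..x} t * (q1 t - q2 t) \<partial>lborel)"
      using q1(4)[OF x] q2(4)[OF x] i by (simp add: right_diff_distrib)
  qed (use q1(1-3) q2(1-3) in auto)
qed

section \<open>Differentiation of indefinite integrals\<close>

text \<open>Difference quotients from the right converge off a negligible set; the same fact for the
  reflected function \<open>f (- x)\<close> gives the quotients from the left.\<close>

lemma AE_has_real_derivative_integral:
  fixes f :: "real \<Rightarrow> real"
  assumes f: "\<And>c d. f integrable_on {c..d}"
  shows "AE x in lebesgue. a < x \<longrightarrow> ((\<lambda>x. integral {a..x} f) has_real_derivative f x) (at x)"
proof -
  obtain N1 where N1: "negligible N1"
    "\<And>x e. x \<notin> N1 \<Longrightarrow> 0 < e \<Longrightarrow> \<exists>d>0. \<forall>h. 0 < h \<and> h < d \<longrightarrow> norm (integral {x..x + h} f / h - f x) < e"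
    using integrable_ccontinuous_explicit[of f] f by (auto simp: divide_inverse mult.commute)
  have fm: "(\<lambda>x. f (- x)) integrable_on {c..d}" for c d
    using Henstock_Kurzweil_Integration.integrable_reflect_real[where f=f and a="- d" and b="- c"] f[of "- d" "- c"] by simp
  obtain N2 where N2: "negligible N2"
    "\<And>x e. x \<notin> N2 \<Longrightarrow> 0 < e \<Longrightarrow> \<exists>d>0. \<forall>h. 0 < h \<and> h < d \<longrightarrow>
       norm (integral {x..x + h} (\<lambda>x. f (- x)) / h - f (- x)) < e"
    using integrable_ccontinuous_explicit[of "\<lambda>x. f (- x)"] fm by (auto simp: divide_inverse mult.commute)
  have neg: "negligible (uminus ` N2)"
    unfolding negligible_def
  proof (intro allI)
    fix c d :: real
    have "indicator (uminus ` N2) = (\<lambda>x. indicat_real N2 (- x))"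
      by (auto simp: fun_eq_iff indicator_def image_iff) (metis minus_minus)
    moreover have "((\<lambda>x. indicat_real N2 (- x)) has_integral 0) {- (- c)..- (- d)}"
      unfolding Henstock_Kurzweil_Integration.has_integral_reflect_real
      using N2(1) unfolding negligible_def by (metis interval_cbox)
    ultimately show "(indicat_real (uminus ` N2) has_integral 0) (cbox c d)" by simp
  qed
  have deriv: "((\<lambda>x. integral {a..x} f) has_real_derivative f x) (at x)"
    if x: "x \<notin> N1" "x \<notin> uminus ` N2" "a < x" for x
    unfolding DERIV_def LIM_eq
  proof (intro allI impI)
    fix e :: real assume e: "e > 0"
    obtain d1 where d1: "d1 > 0"
      "\<forall>h. 0 < h \<and> h < d1 \<longrightarrow> norm (integral {x..x + h} f / h - f x) < e"
      using N1(2)[OF x(1) e] by metis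
    have "- x \<notin> N2" using x(2) by (metis image_eqI minus_minus)
    then obtain d2 where d2: "d2 > 0"
      "\<forall>h. 0 < h \<and> h < d2 \<longrightarrow> norm (integral {- x..- x + h} (\<lambda>x. f (- x)) / h - f (- (- x))) < e"
      using N2(2)[OF _ e] by metis
    \<comment> \<open>The bound \<open>x - a\<close> keeps \<open>x + h\<close> to the right of
      \<open>a\<close>, so that the integrals can be combined.\<close>
    define d where "d = min (min d1 d2) (x - a)"
    have "norm ((integral {a..x + h} f - integral {a..x} f) / h - f x) < e"
      if h: "h \<noteq> 0" "norm h < d" for h
    proof (cases "h > 0")
      case True
      have "integral {a..x} f + integral {x..x + h} f = integral {a..x + h} f"
        by (rule Henstock_Kurzweil_Integration.integral_combine) (use True x(3) f in auto)
      then have "integral {a..x + h} f - integral {a..x} f = integral {x..x + h} f" by simp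
      then show ?thesis using d1(2) True h by (simp add: d_def)
    next
      case False
      then have h': "0 < - h" "- h < d2" "a \<le> x + h" using h by (auto simp: d_def)
      have "integral {a..x + h} f + integral {x + h..x} f = integral {a..x} f"
        by (rule Henstock_Kurzweil_Integration.integral_combine) (use h' f in auto)
      then have "integral {a..x + h} f - integral {a..x} f = - integral {x + h..x} f" by linarith
      moreover have "integral {- x..- x + - h} (\<lambda>x. f (- x)) = integral {x + h..x} f"
        using Henstock_Kurzweil_Integration.integral_reflect_real[where f=f and a="x + h" and b=x] by simp
      ultimately have "(integral {a..x + h} f - integral {a..x} f) / h = integral {- x..- x + - h} (\<lambda>x. f (- x)) / (- h)"
        by simp
      moreover have "norm (integral {- x..- x + - h} (\<lambda>x. f (- x)) / (- h) - f (- (- x))) < e"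
        using d2(2) h' by blast
      ultimately show ?thesis by simp
    qed
    then show "\<exists>s>0. \<forall>h. h \<noteq> 0 \<and> norm (h - 0) < s \<longrightarrow>
        norm ((integral {a..x + h} f - integral {a..x} f) / h - f x) < e"
      using d1(1) d2(1) x(3) by (intro exI[of _ d]) (simp add: d_def)
  qed
  have "negligible (N1 \<union> uminus ` N2)" using N1(1) neg by simp
  then have "N1 \<union> uminus ` N2 \<in> null_sets lebesgue" by (simp add: negligible_iff_null_sets)
  then show ?thesis
    by (rule AE_I') (use deriv in auto)
qed

text \<open>Integrability is available only on \<open>{a..<x}\<close> with \<open>x < b\<close>, as
  for the column of a kernel at \<open>a\<close>. The function is therefore cut off at some
  \<open>c < b\<close>, and a sequence of such points exhausts the interval.\<close>

lemma AE_has_real_derivative_LINT: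
  fixes f :: "real \<Rightarrow> real"
  assumes f: "\<And>x. a < x \<Longrightarrow> x < b \<Longrightarrow> set_integrable lebesgue {a..<x} f"
  shows "AE x in lebesgue. a < x \<and> x < b \<longrightarrow>
    ((\<lambda>x. LINT t:{a..<x}|lebesgue. f t) has_real_derivative f x) (at x)"
proof -
  have main: "AE x in lebesgue. a < x \<and> x < c \<longrightarrow>
    ((\<lambda>x. LINT t:{a..<x}|lebesgue. f t) has_real_derivative f x) (at x)" if c: "a < c" "c < b" for c
  proof -
    define g where "g t = indicator {a..<c} t *\<^sub>R f t" for t
    have g: "integrable lebesgue g" using f[OF c] by (simp add: g_def[abs_def] set_integrable_def)
    have gs: "set_integrable lebesgue {u..v} g" for u v
      unfolding set_integrable_def by (rule integrable_mult_indicator[OF _ g]) simp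
    have gi: "g integrable_on {u..v}" for u v
      using set_lebesgue_integral_eq_integral(1)[OF gs] .
    have eq: "(LINT t:{a..<y}|lebesgue. f t) = integral {a..y} g" if "y < c" for y
    proof -
      have "AE t in lebesgue. t \<noteq> y"
        using AE_lborel_singleton[of y] by (simp add: AE_completion)
      then have "AE t in lebesgue. indicator {a..<y} t *\<^sub>R f t = indicator {a..y} t *\<^sub>R g t"
        by eventually_elim (use \<open>y < c\<close> in \<open>auto simp: g_def indicator_def\<close>)
      moreover have "(\<lambda>t. indicator {a..<y} t *\<^sub>R f t) = (\<lambda>t. indicator {a..<y} t *\<^sub>R g t)"
        using \<open>y < c\<close> by (auto simp: g_def indicator_def fun_eq_iff)
      moreover have "(\<lambda>t. indicator {a..<y} t *\<^sub>R g t) \<in> borel_measurable lebesgue"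
        "(\<lambda>t. indicator {a..y} t *\<^sub>R g t) \<in> borel_measurable lebesgue"
        by (rule borel_measurable_integrable, rule integrable_mult_indicator[OF _ g], simp)+
      ultimately have "(LINT t:{a..<y}|lebesgue. f t) = (LINT t:{a..y}|lebesgue. g t)"
        unfolding set_lebesgue_integral_def by (intro integral_cong_AE) auto
      then show ?thesis using set_lebesgue_integral_eq_integral(2)[OF gs] by simp
    qed
    show ?thesis
      using AE_has_real_derivative_integral[OF gi, of a]
    proof eventually_elim
      case (elim x)
      show ?case
      proof
        assume x: "a < x \<and> x < c"
        then have "((\<lambda>x. integral {a..x} g) has_real_derivative g x) (at x)" using elim by simp
        then have "((\<lambda>x. LINT t:{a..<x}|lebesgue. f t) has_real_derivative g x) (at x)"
        proof (rule has_field_derivative_transform_within_open)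
          show "integral {a..y} g = (LINT t:{a..<y}|lebesgue. f t)" if "y \<in> {..<c}" for y
            using eq[of y] that by simp
        qed (use x in auto)
        then show "((\<lambda>x. LINT t:{a..<x}|lebesgue. f t) has_real_derivative f x) (at x)"
          using x by (simp add: g_def)
      qed
    qed
  qed
  \<comment> \<open>Tends to \<open>b\<close> from below; the midpoint keeps it above
    \<open>a\<close> for small \<open>n\<close>.\<close>
  define c where "c n = max ((a + b) / 2) (b - 1 / real (Suc n))" for n
  show ?thesis
  proof (cases "a < b")
    case True
    have c: "a < c n" "c n < b" for n
      using True by (auto simp: c_def less_max_iff_disj)
    have "AE x in lebesgue. \<forall>n. a < x \<and> x < c n \<longrightarrow>
        ((\<lambda>x. LINT t:{a..<x}|lebesgue. f t) has_real_derivative f x) (at x)"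
      unfolding AE_all_countable using main[OF c] by blast
    then show ?thesis
    proof eventually_elim
      case (elim x)
      show ?case
      proof
        assume x: "a < x \<and> x < b"
        obtain n where "1 / real (Suc n) < b - x" using nat_approx_posE[of "b - x"] x by auto
        then have "x < c n" by (simp add: c_def less_max_iff_disj)
        then show "((\<lambda>x. LINT t:{a..<x}|lebesgue. f t) has_real_derivative f x) (at x)"
          using elim x by blast
      qed
    qed
  qed auto
qed

section \<open>Iterated integrals of Lebesgue measurable kernels\<close>

text \<open>Lebesgue measure is complete, so two preimages that differ by a null set are measurable
  together.\<close>

lemma borel_measurable_lebesgue_cong_AE:
  fixes f g :: "'a::euclidean_space \<Rightarrow> 'b::topological_space"
  assumes f: "f \<in> borel_measurable lebesgue" and eq: "AE x in lborel. g x = f x"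
  shows "g \<in> borel_measurable lebesgue"
proof (rule measurableI)
  fix A :: "'b set" assume A: "A \<in> sets borel"
  have fA: "f -` A \<in> sets lebesgue" using measurable_sets[OF f A] by simp
  have "AE x in lebesgue. x \<in> f -` A \<longleftrightarrow> x \<in> g -` A"
    using AE_completion[OF eq] by eventually_elim simp
  from completion.in_sets_AE[OF this fA] have "g -` A \<in> sets lebesgue" by simp
  then show "g -` A \<inter> space lebesgue \<in> sets lebesgue" by simp
qed simp

lemma borel_representative:
  fixes f :: "'a::euclidean_space \<Rightarrow> ennreal"
  assumes "f \<in> borel_measurable lebesgue"
  obtains f0 where "f0 \<in> borel_measurable borel" "AE x in lborel. f x = f0 x"
  using completion_ex_borel_measurable[OF assms] by auto

text \<open>The exceptional set is enlarged to a Borel null set, for which almost all sections are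
  null and the two quantifiers can be exchanged.\<close>

lemma AE_lborel_pair:
  fixes P :: "'a::euclidean_space \<times> 'b::euclidean_space \<Rightarrow> bool"
  assumes "AE p in lborel. P p"
  shows "AE x in lborel. AE y in lborel. P (x, y)" "AE y in lborel. AE x in lborel. P (x, y)"
proof -
  obtain N where N: "{p \<in> space lborel. \<not> P p} \<subseteq> N" "emeasure lborel N = 0" "N \<in> sets lborel"
    using AE_E[OF assms] by auto
  have "AE p in lborel. p \<notin> N"
    by (rule AE_not_in) (use N in auto)
  then have "AE p in lborel \<Otimes>\<^sub>M lborel. (p :: 'a \<times> 'b) \<notin> N" unfolding lborel_prod .
  then have 1: "AE x in lborel. AE y in lborel. (x, y) \<notin> N"
    by (rule lborel_pair.AE_pair)
  have "{p \<in> space (lborel \<Otimes>\<^sub>M lborel). (fst p, snd p) \<notin> N} = - N"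
    by (auto simp: lborel_prod)
  also have "\<dots> \<in> sets (lborel \<Otimes>\<^sub>M lborel)" unfolding lborel_prod using N(3) by simp
  finally have "(AE x in lborel. AE y in lborel. (x, y) \<notin> N) \<longleftrightarrow> (AE y in lborel. AE x in lborel. (x, y) \<notin> N)"
    by (rule lborel_pair.AE_commute)
  with 1 have 2: "AE y in lborel. AE x in lborel. (x, y) \<notin> N" by simp
  have P: "P p" if "p \<notin> N" for p using N(1) that by auto
  show "AE x in lborel. AE y in lborel. P (x, y)"
    using 1
  proof eventually_elim
    case (elim z)
    then show ?case by eventually_elim (rule P)
  qed
  show "AE y in lborel. AE x in lborel. P (x, y)"
    using 2
  proof eventually_elim
    case (elim z)
    then show ?case by eventually_elim (rule P)
  qed
qed

text \<open>All sections of a Borel representative are measurable, and almost every section of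
  \<open>K\<close> agrees with one almost everywhere. A null set of the plane can have a
  nonmeasurable section, which is why exceptions remain.\<close>

lemma AE_section_measurable:
  fixes K :: "'a::euclidean_space \<Rightarrow> 'b::euclidean_space \<Rightarrow> ennreal"
  assumes "(\<lambda>(x, y). K x y) \<in> borel_measurable lebesgue"
  shows "AE x in lebesgue. (\<lambda>y. K x y) \<in> borel_measurable lebesgue"
    and "AE y in lebesgue. (\<lambda>x. K x y) \<in> borel_measurable lebesgue"
proof -
  obtain K0 where K0[measurable]: "K0 \<in> borel_measurable (borel :: ('a \<times> 'b) measure)"
    and eq: "AE p in lborel. (case p of (x, y) \<Rightarrow> K x y) = K0 p"
    using borel_representative[OF assms] by auto
  have m: "K0 \<in> borel_measurable (borel \<Otimes>\<^sub>M borel)" using K0 by (simp add: borel_prod)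
  have m1: "(\<lambda>y. K0 (x, y)) \<in> borel_measurable lebesgue" for x
    by (intro measurable_completion) (use measurable_Pair2[OF m] in simp)
  have m2: "(\<lambda>x. K0 (x, y)) \<in> borel_measurable lebesgue" for y
    by (intro measurable_completion) (use measurable_Pair1[OF m] in simp)
  show "AE x in lebesgue. (\<lambda>y. K x y) \<in> borel_measurable lebesgue"
    by (rule AE_completion, rule AE_mp[OF AE_lborel_pair(1)[OF eq]], rule AE_I2)
      (simp add: borel_measurable_lebesgue_cong_AE[OF m1])
  show "AE y in lebesgue. (\<lambda>x. K x y) \<in> borel_measurable lebesgue"
    by (rule AE_completion, rule AE_mp[OF AE_lborel_pair(2)[OF eq]], rule AE_I2)
      (simp add: borel_measurable_lebesgue_cong_AE[OF m2])
qed

text \<open>The kernel is measurable for the completion of the product measure, not for the product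
  of the completions. Tonelli is applied to Borel representatives, and the iterated integrals do not
  see the difference.\<close>

lemma lebesgue_Tonelli:
  fixes K :: "'a::euclidean_space \<Rightarrow> 'b::euclidean_space \<Rightarrow> ennreal"
  assumes K: "(\<lambda>(x, y). K x y) \<in> borel_measurable lebesgue"
    and u: "u \<in> borel_measurable lebesgue" and v: "v \<in> borel_measurable lebesgue"
  shows "(\<integral>\<^sup>+x. u x * (\<integral>\<^sup>+y. K x y * v y \<partial>lebesgue) \<partial>lebesgue) =
         (\<integral>\<^sup>+y. (\<integral>\<^sup>+x. u x * K x y \<partial>lebesgue) * v y \<partial>lebesgue)"
    and "(\<lambda>x. \<integral>\<^sup>+y. K x y * v y \<partial>lebesgue) \<in> borel_measurable lebesgue"
proof -
  obtain K0 where K0: "K0 \<in> borel_measurable (borel :: ('a \<times> 'b) measure)"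
    and Keq: "AE p in lborel. (case p of (x, y) \<Rightarrow> K x y) = K0 p"
    using borel_representative[OF K] by auto
  obtain u0 where u0[measurable]: "u0 \<in> borel_measurable borel" and ueq: "AE x in lborel. u x = u0 x"
    using borel_representative[OF u] by auto
  obtain v0 where v0[measurable]: "v0 \<in> borel_measurable borel" and veq: "AE x in lborel. v x = v0 x"
    using borel_representative[OF v] by auto
  have [measurable]: "K0 \<in> borel_measurable (borel \<Otimes>\<^sub>M borel)" using K0 by (simp add: borel_prod)
  have 1: "AE x in lborel. (\<integral>\<^sup>+y. K x y * v y \<partial>lborel) = (\<integral>\<^sup>+y. K0 (x, y) * v0 y \<partial>lborel)"
    using AE_lborel_pair(1)[OF Keq]
  proof eventually_elim
    case (elim x)
    show ?case
      by (rule nn_integral_cong_AE) (use elim veq in \<open>eventually_elim, simp\<close>)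
  qed
  have 2: "AE y in lborel. (\<integral>\<^sup>+x. u x * K x y \<partial>lborel) = (\<integral>\<^sup>+x. u0 x * K0 (x, y) \<partial>lborel)"
    using AE_lborel_pair(2)[OF Keq]
  proof eventually_elim
    case (elim y)
    show ?case
      by (rule nn_integral_cong_AE) (use elim ueq in \<open>eventually_elim, simp\<close>)
  qed
  have "(\<integral>\<^sup>+x. u x * (\<integral>\<^sup>+y. K x y * v y \<partial>lborel) \<partial>lborel) =
      (\<integral>\<^sup>+x. u0 x * (\<integral>\<^sup>+y. K0 (x, y) * v0 y \<partial>lborel) \<partial>lborel)"
    by (rule nn_integral_cong_AE) (use 1 ueq in \<open>eventually_elim, simp\<close>)
  also have "\<dots> = (\<integral>\<^sup>+x. (\<integral>\<^sup>+y. u0 x * K0 (x, y) * v0 y \<partial>lborel) \<partial>lborel)"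
    by (simp add: nn_integral_cmult mult.assoc)
  also have "\<dots> = (\<integral>\<^sup>+y. (\<integral>\<^sup>+x. u0 x * K0 (x, y) * v0 y \<partial>lborel) \<partial>lborel)"
    by (rule lborel_pair.Fubini') measurable
  also have "\<dots> = (\<integral>\<^sup>+y. (\<integral>\<^sup>+x. u0 x * K0 (x, y) \<partial>lborel) * v0 y \<partial>lborel)"
    by (simp add: nn_integral_multc)
  also have "\<dots> = (\<integral>\<^sup>+y. (\<integral>\<^sup>+x. u x * K x y \<partial>lborel) * v y \<partial>lborel)"
    by (rule nn_integral_cong_AE) (use 2 veq in \<open>eventually_elim, simp\<close>)
  finally show "(\<integral>\<^sup>+x. u x * (\<integral>\<^sup>+y. K x y * v y \<partial>lebesgue) \<partial>lebesgue) =
         (\<integral>\<^sup>+y. (\<integral>\<^sup>+x. u x * K x y \<partial>lebesgue) * v y \<partial>lebesgue)"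
    by (simp add: nn_integral_completion)
  have "(\<lambda>x. \<integral>\<^sup>+y. K0 (x, y) * v0 y \<partial>lborel) \<in> borel_measurable lborel" by measurable
  from borel_measurable_lebesgue_cong_AE[OF measurable_completion[OF this] 1]
  show "(\<lambda>x. \<integral>\<^sup>+y. K x y * v y \<partial>lebesgue) \<in> borel_measurable lebesgue"
    by (simp add: nn_integral_completion)
qed

text \<open>Tonelli transfers finiteness to the other order, so the inner integral is finite for
  almost every \<open>x\<close> with \<open>p x\<close> nonzero. Where \<open>p x = 0\<close> it may
  diverge, and the factor removes it.\<close>

lemma lebesgue_Fubini_nonneg:
  fixes K :: "'a::euclidean_space \<Rightarrow> 'b::euclidean_space \<Rightarrow> real"
  assumes K: "(\<lambda>(x, y). K x y) \<in> borel_measurable lebesgue" "\<And>x y. K x y \<ge> 0"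
    and p: "p \<in> borel_measurable lebesgue" "\<And>x. p x \<ge> 0"
    and u: "u \<in> borel_measurable lebesgue" "\<And>y. u y \<ge> 0"
    and fin: "(\<integral>\<^sup>+y. (\<integral>\<^sup>+x. ennreal (p x * K x y) \<partial>lebesgue) * ennreal (u y) \<partial>lebesgue) < \<infinity>"
  shows "AE x in lebesgue. p x \<noteq> 0 \<longrightarrow> integrable lebesgue (\<lambda>y. K x y * u y)"
    and "has_bochner_integral lebesgue (\<lambda>x. p x * (\<integral>y. K x y * u y \<partial>lebesgue))
      (enn2real (\<integral>\<^sup>+y. (\<integral>\<^sup>+x. ennreal (p x * K x y) \<partial>lebesgue) * ennreal (u y) \<partial>lebesgue))"
proof -
  define A where "A x = (\<integral>\<^sup>+y. ennreal (K x y) * ennreal (u y) \<partial>lebesgue)" for x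
  have "(\<lambda>p. ennreal (case p of (x, y) \<Rightarrow> K x y)) \<in> borel_measurable lebesgue" using K(1) by measurable
  then have K': "(\<lambda>(x, y). ennreal (K x y)) \<in> borel_measurable lebesgue" by (simp add: case_prod_unfold)
  have p': "(\<lambda>x. ennreal (p x)) \<in> borel_measurable lebesgue" using p(1) by measurable
  have u': "(\<lambda>x. ennreal (u x)) \<in> borel_measurable lebesgue" using u(1) by measurable
  define I where "I = (\<integral>\<^sup>+y. (\<integral>\<^sup>+x. ennreal (p x * K x y) \<partial>lebesgue) * ennreal (u y) \<partial>lebesgue)"
  have Am: "A \<in> borel_measurable lebesgue"
    unfolding A_def[abs_def] by (rule lebesgue_Tonelli(2)[OF K' p' u'])
  have int: "(\<integral>\<^sup>+x. ennreal (p x) * A x \<partial>lebesgue) = I"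
    unfolding A_def I_def lebesgue_Tonelli(1)[OF K' p' u'] using p(2) K(2) by (simp add: ennreal_mult)
  have pA: "(\<lambda>x. ennreal (p x) * A x) \<in> borel_measurable lebesgue"
    using p' Am by measurable
  have "AE x in lebesgue. ennreal (p x) * A x \<noteq> \<infinity>"
    by (rule nn_integral_PInf_AE[OF pA]) (use fin in \<open>simp add: int I_def less_top\<close>)
  then have ae: "AE x in lebesgue. p x \<noteq> 0 \<longrightarrow>
      integrable lebesgue (\<lambda>y. K x y * u y) \<and> ennreal (\<integral>y. K x y * u y \<partial>lebesgue) = A x"
    using AE_section_measurable(1)[OF K']
  proof eventually_elim
    case (elim x)
    show ?case
    proof
      assume "p x \<noteq> 0"
      then have "A x \<noteq> \<infinity>" using elim(1) p(2)[of x] by (auto simp: ennreal_mult_eq_top_iff)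
      have "(\<lambda>y. enn2real (ennreal (K x y)) * u y) \<in> borel_measurable lebesgue"
        using elim(2) u(1) by measurable
      then have m: "(\<lambda>y. K x y * u y) \<in> borel_measurable lebesgue" using K(2) by simp
      have nn: "A x = (\<integral>\<^sup>+y. ennreal (K x y * u y) \<partial>lebesgue)"
        unfolding A_def using K(2) u(2) by (simp add: ennreal_mult)
      have i: "integrable lebesgue (\<lambda>y. K x y * u y)"
        by (rule integrableI_nonneg[OF m]) (use K(2) u(2) \<open>A x \<noteq> \<infinity>\<close> nn in \<open>simp_all add: less_top\<close>)
      show "integrable lebesgue (\<lambda>y. K x y * u y) \<and> ennreal (\<integral>y. K x y * u y \<partial>lebesgue) = A x"
        using i nn_integral_eq_integral[OF i] K(2) u(2) nn by simp
    qed
  qed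
  show "AE x in lebesgue. p x \<noteq> 0 \<longrightarrow> integrable lebesgue (\<lambda>y. K x y * u y)"
    using ae by eventually_elim simp
  have nonneg: "(\<integral>y. K x y * u y \<partial>lebesgue) \<ge> 0" for x
    by (rule Bochner_Integration.integral_nonneg) (use K(2) u(2) in simp)
  have eq: "AE x in lebesgue. ennreal (p x * (\<integral>y. K x y * u y \<partial>lebesgue)) = ennreal (p x) * A x"
    using ae
  proof eventually_elim
    case (elim x)
    then show ?case
      using p(2)[of x] nonneg[of x] by (cases "p x = 0") (simp_all add: ennreal_mult)
  qed
  have "AE x in lebesgue. enn2real (ennreal (p x) * A x) = p x * (\<integral>y. K x y * u y \<partial>lebesgue)"
    using eq
  proof eventually_elim
    case (elim x)
    then show ?case
      using p(2)[of x] nonneg[of x] by (metis enn2real_ennreal mult_nonneg_nonneg)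
  qed
  moreover have "(\<lambda>x. enn2real (ennreal (p x) * A x)) \<in> borel_measurable lebesgue"
    using pA by measurable
  ultimately have m: "(\<lambda>x. p x * (\<integral>y. K x y * u y \<partial>lebesgue)) \<in> borel_measurable lebesgue"
    by (rule borel_measurable_AE[rotated])
  have "has_bochner_integral lebesgue (\<lambda>x. p x * (\<integral>y. K x y * u y \<partial>lebesgue)) (enn2real I)"
  proof (rule has_bochner_integral_nn_integral[OF m])
    show "AE x in lebesgue. 0 \<le> p x * (\<integral>y. K x y * u y \<partial>lebesgue)"
      using p(2) nonneg by simp
    show "(\<integral>\<^sup>+x. ennreal (p x * (\<integral>y. K x y * u y \<partial>lebesgue)) \<partial>lebesgue) = ennreal (enn2real I)"
      using nn_integral_cong_AE[OF eq] int fin by (simp add: I_def less_top)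
  qed simp
  then show "has_bochner_integral lebesgue (\<lambda>x. p x * (\<integral>y. K x y * u y \<partial>lebesgue))
      (enn2real (\<integral>\<^sup>+y. (\<integral>\<^sup>+x. ennreal (p x * K x y) \<partial>lebesgue) * ennreal (u y) \<partial>lebesgue))"
    by (simp add: I_def)
qed

text \<open>Apply the nonnegative case to the positive and negative parts of \<open>u\<close>. For
  conjugate kernels \<open>p\<close> is a weighted row and \<open>\<beta>\<close> the composed
  kernel, an indicator.\<close>

lemma lebesgue_Fubini_weighted:
  fixes K :: "'a::euclidean_space \<Rightarrow> 'b::euclidean_space \<Rightarrow> real"
  assumes K: "(\<lambda>(x, y). K x y) \<in> borel_measurable lebesgue" "\<And>x y. K x y \<ge> 0"
    and p: "p \<in> borel_measurable lebesgue" "\<And>x. p x \<ge> 0"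
    and u: "u \<in> borel_measurable lebesgue"
    and fin: "(\<integral>\<^sup>+y. (\<integral>\<^sup>+x. ennreal (p x * K x y) \<partial>lebesgue) * ennreal \<bar>u y\<bar> \<partial>lebesgue) < \<infinity>"
  shows "AE x in lebesgue. p x \<noteq> 0 \<longrightarrow> integrable lebesgue (\<lambda>y. K x y * u y)"
    and "integrable lebesgue (\<lambda>x. p x * (\<integral>y. K x y * u y \<partial>lebesgue))"
    and "\<And>\<beta>. \<beta> \<in> borel_measurable lebesgue \<Longrightarrow> (\<And>y. \<beta> y \<ge> 0) \<Longrightarrow>
      (\<And>y. (\<integral>\<^sup>+x. ennreal (p x * K x y) \<partial>lebesgue) = ennreal (\<beta> y)) \<Longrightarrow>
      (\<integral>x. p x * (\<integral>y. K x y * u y \<partial>lebesgue) \<partial>lebesgue) = (\<integral>y. \<beta> y * u y \<partial>lebesgue)"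
proof -
  define u1 where "u1 y = max (u y) 0" for y
  define u2 where "u2 y = max (- u y) 0" for y
  have um: "u1 \<in> borel_measurable lebesgue" "u2 \<in> borel_measurable lebesgue"
    unfolding u1_def[abs_def] u2_def[abs_def] using u by measurable
  have u0: "u1 y \<ge> 0" "u2 y \<ge> 0" "u1 y \<le> \<bar>u y\<bar>" "u2 y \<le> \<bar>u y\<bar>" "u y = u1 y - u2 y" for y
    by (auto simp: u1_def u2_def)
  have fin1: "(\<integral>\<^sup>+y. (\<integral>\<^sup>+x. ennreal (p x * K x y) \<partial>lebesgue) * ennreal (u1 y) \<partial>lebesgue) < \<infinity>"
    by (rule le_less_trans[OF nn_integral_mono fin]) (intro mult_left_mono ennreal_leI u0 zero_le)
  have fin2: "(\<integral>\<^sup>+y. (\<integral>\<^sup>+x. ennreal (p x * K x y) \<partial>lebesgue) * ennreal (u2 y) \<partial>lebesgue) < \<infinity>"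
    by (rule le_less_trans[OF nn_integral_mono fin]) (intro mult_left_mono ennreal_leI u0 zero_le)
  note F1 = lebesgue_Fubini_nonneg[OF K p um(1) u0(1) fin1]
  note F2 = lebesgue_Fubini_nonneg[OF K p um(2) u0(2) fin2]
  have ae: "AE x in lebesgue. p x \<noteq> 0 \<longrightarrow> integrable lebesgue (\<lambda>y. K x y * u y) \<and>
      (\<integral>y. K x y * u y \<partial>lebesgue) = (\<integral>y. K x y * u1 y \<partial>lebesgue) - (\<integral>y. K x y * u2 y \<partial>lebesgue)"
    using F1(1) F2(1)
  proof eventually_elim
    case (elim x)
    have "(\<lambda>y. K x y * u y) = (\<lambda>y. K x y * u1 y - K x y * u2 y)"
      using u0(5) by (simp add: right_diff_distrib)
    then show ?case using elim by simp
  qed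
  then show "AE x in lebesgue. p x \<noteq> 0 \<longrightarrow> integrable lebesgue (\<lambda>y. K x y * u y)"
    by eventually_elim simp
  let ?J1 = "\<lambda>x. p x * (\<integral>y. K x y * u1 y \<partial>lebesgue)" and ?J2 = "\<lambda>x. p x * (\<integral>y. K x y * u2 y \<partial>lebesgue)"
  have eq: "AE x in lebesgue. ?J1 x - ?J2 x = p x * (\<integral>y. K x y * u y \<partial>lebesgue)"
    using ae
  proof eventually_elim
    case (elim x)
    then show ?case by (cases "p x = 0") (simp_all add: right_diff_distrib)
  qed
  have J: "integrable lebesgue ?J1" "integrable lebesgue ?J2"
    using F1(2) F2(2) by (auto simp: has_bochner_integral_iff)
  have Jd: "integrable lebesgue (\<lambda>x. ?J1 x - ?J2 x)" using J by simp
  have m: "(\<lambda>x. p x * (\<integral>y. K x y * u y \<partial>lebesgue)) \<in> borel_measurable lebesgue"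
    by (rule borel_measurable_AE[OF borel_measurable_integrable[OF Jd] eq])
  show "integrable lebesgue (\<lambda>x. p x * (\<integral>y. K x y * u y \<partial>lebesgue))"
    by (rule Bochner_Integration.integrable_cong_AE_imp[OF Jd m]) (use eq in \<open>eventually_elim, simp\<close>)
  fix \<beta> assume \<beta>: "\<beta> \<in> borel_measurable lebesgue" "\<And>y. \<beta> y \<ge> 0"
    "\<And>y. (\<integral>\<^sup>+x. ennreal (p x * K x y) \<partial>lebesgue) = ennreal (\<beta> y)"
  have beta: "has_bochner_integral lebesgue (\<lambda>y. \<beta> y * v y) (enn2real (\<integral>\<^sup>+y. ennreal (\<beta> y) * ennreal (v y) \<partial>lebesgue))"
    if v: "v \<in> borel_measurable lebesgue" "\<And>y. v y \<ge> 0" "(\<integral>\<^sup>+y. ennreal (\<beta> y) * ennreal (v y) \<partial>lebesgue) < \<infinity>" for v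
  proof (rule has_bochner_integral_nn_integral)
    show "(\<lambda>y. \<beta> y * v y) \<in> borel_measurable lebesgue" using \<beta>(1) v(1) by measurable
    show "(\<integral>\<^sup>+y. ennreal (\<beta> y * v y) \<partial>lebesgue) = ennreal (enn2real (\<integral>\<^sup>+y. ennreal (\<beta> y) * ennreal (v y) \<partial>lebesgue))"
      using v \<beta>(2) by (simp add: ennreal_mult less_top)
  qed (use v \<beta>(2) in auto)
  have b1: "has_bochner_integral lebesgue (\<lambda>y. \<beta> y * u1 y) (integral\<^sup>L lebesgue ?J1)"
    using beta[OF um(1) u0(1)] fin1 F1(2) unfolding \<beta>(3) by (simp add: has_bochner_integral_iff)
  have b2: "has_bochner_integral lebesgue (\<lambda>y. \<beta> y * u2 y) (integral\<^sup>L lebesgue ?J2)"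
    using beta[OF um(2) u0(2)] fin2 F2(2) unfolding \<beta>(3) by (simp add: has_bochner_integral_iff)
  have "(\<integral>x. p x * (\<integral>y. K x y * u y \<partial>lebesgue) \<partial>lebesgue) = (\<integral>x. ?J1 x - ?J2 x \<partial>lebesgue)"
    by (rule integral_cong_AE[OF m borel_measurable_integrable[OF Jd]]) (use eq in \<open>eventually_elim, simp\<close>)
  also have "\<dots> = integral\<^sup>L lebesgue ?J1 - integral\<^sup>L lebesgue ?J2" using J by simp
  also have "\<dots> = (\<integral>y. \<beta> y * u1 y \<partial>lebesgue) - (\<integral>y. \<beta> y * u2 y \<partial>lebesgue)"
    using b1 b2 by (simp add: has_bochner_integral_iff)
  also have "\<dots> = (\<integral>y. \<beta> y * u1 y - \<beta> y * u2 y \<partial>lebesgue)"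
    using b1 b2 by (simp add: has_bochner_integral_iff)
  also have "\<dots> = (\<integral>y. \<beta> y * u y \<partial>lebesgue)"
    using u0(5) by (simp add: right_diff_distrib)
  finally show "(\<integral>x. p x * (\<integral>y. K x y * u y \<partial>lebesgue) \<partial>lebesgue) = (\<integral>y. \<beta> y * u y \<partial>lebesgue)" .
qed

section \<open>Kernels on the triangle\<close>

text \<open>A nonempty open interval is not null, so it meets every set of full measure. This
  supplies good sections near \<open>a\<close> and good rows between \<open>x\<close> and
  \<open>b\<close>.\<close>

lemma AE_lebesgue_ex_between:
  fixes c d :: real
  assumes "AE y in lebesgue. P y" "c < d"
  obtains y where "c < y" "y < d" "P y"
proof -
  have "\<exists>y\<in>{c<..<d}. P y"
  proof (rule ccontr)
    assume "\<not> ?thesis"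
    with assms(1) have "AE y in lebesgue. y \<notin> {c<..<d}" by (auto elim!: eventually_mono)
    then have "{c<..<d} \<in> null_sets lebesgue" by (subst completion.null_sets_iff_AE) simp
    then show False using \<open>c < d\<close> by (simp add: null_sets_def)
  qed
  then show ?thesis using that by auto
qed

lemma borel_measurable_restrict_zero:
  fixes f :: "'a::euclidean_space \<Rightarrow> real"
  assumes "f \<in> borel_measurable (lebesgue_on S)" "S \<in> sets lebesgue"
    and "\<And>x. x \<in> S \<Longrightarrow> g x = f x" "\<And>x. x \<notin> S \<Longrightarrow> g x = 0"
  shows "g \<in> borel_measurable lebesgue"
proof -
  have "(\<lambda>x. indicator S x *\<^sub>R f x) \<in> borel_measurable lebesgue"
    using assms(1,2) by (subst (asm) borel_measurable_restrict_space_iff) simp_all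
  also have "(\<lambda>x. indicator S x *\<^sub>R f x) = g"
    using assms(3,4) by (auto simp: fun_eq_iff indicator_def)
  finally show ?thesis .
qed

lemma AE_lebesgue_on_iff:
  assumes "S \<in> sets lebesgue"
  shows "(AE x in lebesgue_on S. P x) \<longleftrightarrow> (AE x in lebesgue. x \<in> S \<longrightarrow> P x)"
  using assms by (subst AE_restrict_space_iff) simp_all

lemma lebesgue_on_eq_cutoff:
  fixes f g :: "'a::euclidean_space \<Rightarrow> real"
  assumes "S \<in> sets lebesgue" "\<And>x. x \<in> S \<Longrightarrow> g x = f x" "\<And>x. x \<notin> S \<Longrightarrow> g x = 0"
  shows "integrable (lebesgue_on S) f \<longleftrightarrow> integrable lebesgue g"
    and "integral\<^sup>L (lebesgue_on S) f = integral\<^sup>L lebesgue g"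
proof -
  have g: "g = (\<lambda>x. indicator S x *\<^sub>R f x)"
    using assms(2,3) by (auto simp: fun_eq_iff indicator_def)
  show "integrable (lebesgue_on S) f \<longleftrightarrow> integrable lebesgue g"
    unfolding g using assms(1) by (subst integrable_restrict_space) simp_all
  show "integral\<^sup>L (lebesgue_on S) f = integral\<^sup>L lebesgue g"
    unfolding g using assms(1) by (subst integral_restrict_space) simp_all
qed

text \<open>Extension by zero moves the varying domains of integration into the kernel, so that
  Tonelli and Fubini apply on the whole plane.\<close>

definition cut_kernel :: "real \<Rightarrow> real \<Rightarrow> kernel \<Rightarrow> kernel" where
  "cut_kernel a b k x y = (if a \<le> y \<and> y < x \<and> x \<le> b then k x y else 0)"

definition cut_weight :: "real \<Rightarrow> real \<Rightarrow> (real \<Rightarrow> real) \<Rightarrow> real \<Rightarrow> real" where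
  "cut_weight a b \<omega> x = (if a \<le> x \<and> x \<le> b then \<omega> x else 0)"

lemma cut_weight_measurable:
  assumes "weight a b \<omega>"
  shows "cut_weight a b \<omega> \<in> borel_measurable lebesgue"
proof (rule borel_measurable_restrict_zero)
  show "\<omega> \<in> borel_measurable (lebesgue_on {a..b})"
    using assms by (simp add: weight_def Linfty_on_def)
qed (auto simp: cut_weight_def)

lemma cut_weight_nonneg: "weight a b \<omega> \<Longrightarrow> cut_weight a b \<omega> x \<ge> 0"
  by (auto simp: cut_weight_def weight_def intro!: less_imp_le)

lemma cut_weight_bounded:
  assumes "weight a b \<omega>"
  obtains C where "C \<ge> 0" "AE x in lebesgue. cut_weight a b \<omega> x \<le> C"
proof -
  obtain C where "AE x in lebesgue_on {a..b}. \<bar>\<omega> x\<bar> \<le> C"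
    using assms unfolding weight_def Linfty_on_def by blast
  then have "AE x in lebesgue. x \<in> {a..b} \<longrightarrow> \<bar>\<omega> x\<bar> \<le> C"
    by (subst (asm) AE_lebesgue_on_iff) simp_all
  then have "AE x in lebesgue. cut_weight a b \<omega> x \<le> \<bar>C\<bar>"
    by eventually_elim (auto simp: cut_weight_def)
  then show ?thesis using that[of "\<bar>C\<bar>"] by simp
qed

lemma triangle_borel: "triangle a b \<in> sets borel"
proof -
  have "triangle a b = ({a..b} \<times> {a..b}) \<inter> {p. snd p < fst p}"
    by (auto simp: triangle_def)
  moreover have "open {p :: real \<times> real. snd p < fst p}"
    by (intro open_Collect_less continuous_intros)
  moreover have "closed ({a..b} \<times> {a..b})" by (intro closed_Times) simp_all
  ultimately show ?thesis by (metis borel_closed borel_open sets.Int)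
qed

lemma cut_kernel_measurable:
  assumes "k \<in> kernels a b \<omega>"
  shows "(\<lambda>(x, y). cut_kernel a b k x y) \<in> borel_measurable lebesgue"
proof (rule borel_measurable_restrict_zero)
  show "(\<lambda>(x, y). k x y) \<in> borel_measurable (lebesgue_on (triangle a b))"
    using assms by (simp add: kernels_def)
  show "triangle a b \<in> sets lebesgue" using triangle_borel by (simp add: sets_completionI_sets)
qed (auto simp: cut_kernel_def triangle_def split: if_splits)

lemma kernels_pos:
  assumes "k \<in> kernels a b \<omega>" "a \<le> y" "y < x" "x \<le> b"
  shows "k x y > 0"
  using assms by (auto simp: kernels_def triangle_def)

lemma cut_kernel_nonneg: "k \<in> kernels a b \<omega> \<Longrightarrow> cut_kernel a b k x y \<ge> 0"
  using kernels_pos[of k a b \<omega> y x] by (auto simp: cut_kernel_def)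

text \<open>The bound on \<open>F_ker\<close> passes to the nonnegative integral because
  \<open>kernels\<close> contains the integrability of almost every column; otherwise a small
  Bochner value could be the default 0.\<close>

lemma cut_kernel_F_bounded:
  assumes w: "weight a b \<omega>" and k: "k \<in> kernels a b \<omega>"
  obtains C where "C \<ge> 0"
    "AE y in lebesgue. (\<integral>\<^sup>+x. ennreal (cut_weight a b \<omega> x * cut_kernel a b k x y) \<partial>lebesgue) \<le> ennreal C"
proof -
  obtain C where "AE y in lebesgue_on {a..<b}. \<bar>F_ker b \<omega> k y\<bar> \<le> C"
    using k unfolding kernels_def Linfty_on_def by blast
  then have C: "AE y in lebesgue. y \<in> {a..<b} \<longrightarrow> \<bar>F_ker b \<omega> k y\<bar> \<le> C"
    by (subst (asm) AE_lebesgue_on_iff) simp_all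
  have "AE y in lebesgue_on {a..<b}. integrable (lebesgue_on {y<..b}) (\<lambda>x. k x y * \<omega> x)"
    using k unfolding kernels_def by blast
  then have "AE y in lebesgue. y \<in> {a..<b} \<longrightarrow> integrable (lebesgue_on {y<..b}) (\<lambda>x. k x y * \<omega> x)"
    by (subst (asm) AE_lebesgue_on_iff) simp_all
  with C have "AE y in lebesgue. (\<integral>\<^sup>+x. ennreal (cut_weight a b \<omega> x * cut_kernel a b k x y) \<partial>lebesgue) \<le> ennreal \<bar>C\<bar>"
  proof eventually_elim
    case (elim y)
    show ?case
    proof (cases "y \<in> {a..<b}")
      case True
      let ?g = "\<lambda>x. cut_weight a b \<omega> x * cut_kernel a b k x y"
      have g: "?g x = k x y * \<omega> x" if "x \<in> {y<..b}" for x
        using that True by (auto simp: cut_weight_def cut_kernel_def)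
      have g0: "?g x = 0" if "x \<notin> {y<..b}" for x
        using that by (auto simp: cut_weight_def cut_kernel_def)
      have S: "{y<..b} \<in> sets lebesgue" by simp
      have "integrable lebesgue ?g"
        using lebesgue_on_eq_cutoff(1)[where g="?g" and f="\<lambda>x. k x y * \<omega> x", OF S g g0] elim True by blast
      moreover have "integral\<^sup>L lebesgue ?g = F_ker b \<omega> k y"
        using lebesgue_on_eq_cutoff(2)[where g="?g" and f="\<lambda>x. k x y * \<omega> x", OF S g g0] by (simp add: F_ker_def)
      ultimately have "(\<integral>\<^sup>+x. ennreal (?g x) \<partial>lebesgue) = ennreal (F_ker b \<omega> k y)"
        using cut_weight_nonneg[OF w] cut_kernel_nonneg[OF k]
        by (subst nn_integral_eq_integral) simp_all
      also have "\<dots> \<le> ennreal \<bar>C\<bar>" using elim True by (intro ennreal_leI) simp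
      finally show ?thesis .
    next
      case False
      then have "cut_kernel a b k x y = 0" for x by (auto simp: cut_kernel_def)
      then show ?thesis by simp
    qed
  qed
  then show ?thesis using that[of "\<bar>C\<bar>"] by simp
qed

lemma cut_kernel_G_finite:
  assumes w: "weight a b \<omega>" and k: "k \<in> kernels a b \<omega>"
  shows "AE x in lebesgue. integrable lebesgue (\<lambda>t. cut_kernel a b k x t * cut_weight a b \<omega> t)"
proof -
  have "AE x in lebesgue_on {a<..b}. integrable (lebesgue_on {a..<x}) (\<lambda>t. k x t * \<omega> t)"
    using k unfolding kernels_def by blast
  then have "AE x in lebesgue. x \<in> {a<..b} \<longrightarrow> integrable (lebesgue_on {a..<x}) (\<lambda>t. k x t * \<omega> t)"
    by (subst (asm) AE_lebesgue_on_iff) simp_all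
  then show ?thesis
  proof eventually_elim
    case (elim x)
    show ?case
    proof (cases "x \<in> {a<..b}")
      case True
      let ?g = "\<lambda>t. cut_kernel a b k x t * cut_weight a b \<omega> t"
      have g: "?g t = k x t * \<omega> t" if "t \<in> {a..<x}" for t
        using that True by (auto simp: cut_weight_def cut_kernel_def)
      have g0: "?g t = 0" if "t \<notin> {a..<x}" for t
        using that by (auto simp: cut_weight_def cut_kernel_def)
      have "{a..<x} \<in> sets lebesgue" by simp
      from lebesgue_on_eq_cutoff(1)[where g="?g" and f="\<lambda>t. k x t * \<omega> t", OF this g g0] show ?thesis using elim True by blast
    next
      case False
      then have "cut_kernel a b k x t = 0" for t by (auto simp: cut_kernel_def)
      then show ?thesis by simp
    qed
  qed
qed

text \<open>Integrating over \<open>x\<close> first leaves the essentially bounded column integrals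
  against \<open>q\<close>, so the weighted operator is bounded on L1. Here \<open>q\<close> stands
  for a function already multiplied by the weight.\<close>

lemma integrable_weight_kernel_operator:
  assumes w: "weight a b \<omega>" and k: "k \<in> kernels a b \<omega>" and q: "integrable lebesgue q"
  shows "integrable lebesgue (\<lambda>x. cut_weight a b \<omega> x * (\<integral>s. cut_kernel a b k x s * q s \<partial>lebesgue))"
proof (rule lebesgue_Fubini_weighted(2)[OF cut_kernel_measurable[OF k] cut_kernel_nonneg[OF k]
      cut_weight_measurable[OF w] cut_weight_nonneg[OF w] borel_measurable_integrable[OF q]])
  obtain C where C: "C \<ge> 0"
    "AE y in lebesgue. (\<integral>\<^sup>+x. ennreal (cut_weight a b \<omega> x * cut_kernel a b k x y) \<partial>lebesgue) \<le> ennreal C"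
    by (rule cut_kernel_F_bounded[OF w k])
  have "(\<integral>\<^sup>+y. (\<integral>\<^sup>+x. ennreal (cut_weight a b \<omega> x * cut_kernel a b k x y) \<partial>lebesgue) * ennreal \<bar>q y\<bar> \<partial>lebesgue)
      \<le> (\<integral>\<^sup>+y. ennreal (C * \<bar>q y\<bar>) \<partial>lebesgue)"
    by (rule nn_integral_mono_AE, use C(2) in eventually_elim)
      (use C(1) in \<open>simp add: ennreal_mult mult_right_mono\<close>)
  also have "\<dots> < \<infinity>"
    using q C(1) by (subst nn_integral_eq_integral) simp_all
  finally show "(\<integral>\<^sup>+y. (\<integral>\<^sup>+x. ennreal (cut_weight a b \<omega> x * cut_kernel a b k x y) \<partial>lebesgue) * ennreal \<bar>q y\<bar> \<partial>lebesgue) < \<infinity>" .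
qed

section \<open>Conjugate kernels\<close>

locale conj_kernels =
  fixes a b :: real and \<omega> :: "real \<Rightarrow> real" and k k' :: kernel
  assumes ab: "a < b" and w: "weight a b \<omega>" and k: "k \<in> kernels a b \<omega>" and k': "k' \<in> kernels a b \<omega>"
    and conj: "conjugate a b \<omega> k k'"
begin

lemma flip: "conj_kernels a b \<omega> k' k"
  using ab w k k' conj by unfold_locales (auto simp: conjugate_def)

abbreviation "W \<equiv> cut_weight a b \<omega>"
abbreviation "K \<equiv> cut_kernel a b k"
abbreviation "K' \<equiv> cut_kernel a b k'"

lemma nonneg: "W x \<ge> 0" "K x y \<ge> 0" "K' x y \<ge> 0"
  using cut_weight_nonneg[OF w] cut_kernel_nonneg[OF k] cut_kernel_nonneg[OF k'] by auto

lemma pos: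
  assumes "a \<le> y" "y < x" "x \<le> b"
  shows "W x > 0" "W y > 0" "K x y > 0" "K' x y > 0"
  using assms w kernels_pos[OF k] kernels_pos[OF k'] by (auto simp: cut_weight_def cut_kernel_def weight_def)

lemma composition_eq_1:
  assumes "a \<le> y" "y < x" "x \<le> b"
  shows "has_bochner_integral lebesgue (\<lambda>z. K x z * W z * K' z y) 1"
proof -
  have 1: "(\<integral>z. k x z * k' z y * \<omega> z \<partial>lebesgue_on {y<..<x}) = 1"
    using conj assms by (auto simp: conjugate_def triangle_def ker_delta_def)
  then have i: "integrable (lebesgue_on {y<..<x}) (\<lambda>z. k x z * k' z y * \<omega> z)"
    using not_integrable_integral_eq by fastforce
  have S: "{y<..<x} \<in> sets lebesgue" by simp
  have g: "K x z * W z * K' z y = k x z * k' z y * \<omega> z" if "z \<in> {y<..<x}" for z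
    using that assms by (auto simp: cut_weight_def cut_kernel_def)
  have g0: "K x z * W z * K' z y = 0" if "z \<notin> {y<..<x}" for z
    using that by (auto simp: cut_kernel_def)
  note c = lebesgue_on_eq_cutoff[where g="\<lambda>z. K x z * W z * K' z y" and f="\<lambda>z. k x z * k' z y * \<omega> z", OF S g g0]
  show ?thesis using c(1) c(2) i 1 by (simp add: has_bochner_integral_iff)
qed

text \<open>The kernel of the composed operator, at every \<open>y\<close>: outside
  \<open>{a..<x}\<close> the two cut kernels are never nonzero together. The \<open>ennreal\<close>
  form is the one that Tonelli produces.\<close>

lemma composition_nn:
  assumes "x \<le> b"
  shows "(\<integral>\<^sup>+z. ennreal (K x z * W z * K' z y) \<partial>lebesgue) = ennreal (indicator {a..<x} y)"
proof (cases "y \<in> {a..<x}")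
  case True
  then have "has_bochner_integral lebesgue (\<lambda>z. K x z * W z * K' z y) 1"
    using assms by (intro composition_eq_1) auto
  then show ?thesis
    using True nonneg by (subst nn_integral_eq_integral) (auto simp: has_bochner_integral_iff)
next
  case False
  then have "K x z * W z * K' z y = 0" for z by (auto simp: cut_kernel_def)
  then have "(\<integral>\<^sup>+z. ennreal (K x z * W z * K' z y) \<partial>lebesgue) = 0" by (simp only: ennreal_0 nn_integral_const mult_zero_left)
  then show ?thesis using False by simp
qed

text \<open>
  A kernel is only jointly measurable, which controls almost every section.  Conjugacy controls
  every row: the integrand of \<open>composition_eq_1\<close> is measurable for all \<open>y\<close>, and it can be
  divided by the section at \<open>y\<close> of the other kernel, which is measurable for suitable \<open>y\<close>
  arbitrarily close to \<open>a\<close>.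
\<close>

lemma row_measurable:
  assumes x: "a < x" "x \<le> b"
  shows "K x \<in> borel_measurable lebesgue"
proof -
  have "(\<lambda>p. ennreal (case p of (x, y) \<Rightarrow> K' x y)) \<in> borel_measurable lebesgue"
    using cut_kernel_measurable[OF k'] by measurable
  then have "(\<lambda>(x, y). ennreal (K' x y)) \<in> borel_measurable lebesgue" by (simp add: case_prod_unfold)
  then have ae: "AE y in lebesgue. (\<lambda>z. ennreal (K' z y)) \<in> borel_measurable lebesgue"
    by (rule AE_section_measurable(2))
  \<comment> \<open>The sections are chosen to approach \<open>a\<close>; \<open>y < x\<close> keeps
    \<open>(x, y)\<close> in the triangle, where the composition equals 1.\<close>
  have "\<exists>y. a < y \<and> y < min x (a + 1 / real (Suc n)) \<and> (\<lambda>z. ennreal (K' z y)) \<in> borel_measurable lebesgue" for n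
    using AE_lebesgue_ex_between[OF ae, of a "min x (a + 1 / real (Suc n))"] x by fastforce
  then obtain Y where Y: "\<And>n. a < Y n" "\<And>n. Y n < min x (a + 1 / real (Suc n))"
      "\<And>n. (\<lambda>z. ennreal (K' z (Y n))) \<in> borel_measurable lebesgue"
    by metis
  \<comment> \<open>The numerator is measurable because it is integrable, and the quotient recovers
    \<open>K x z\<close> to the right of \<open>Y n\<close>.\<close>
  define g where "g n z = indicator {Y n<..<x} z * ((K x z * W z * K' z (Y n)) / (W z * K' z (Y n)))" for n z
  have gm: "g n \<in> borel_measurable lebesgue" for n
  proof -
    have "(\<lambda>z. enn2real (ennreal (K' z (Y n)))) \<in> borel_measurable lebesgue"
      using Y(3)[of n] by measurable
    then have 1: "(\<lambda>z. K' z (Y n)) \<in> borel_measurable lebesgue" using nonneg by simp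
    have "has_bochner_integral lebesgue (\<lambda>z. K x z * W z * K' z (Y n)) 1"
      using Y(1,2)[of n] x by (intro composition_eq_1) auto
    then have 2: "(\<lambda>z. K x z * W z * K' z (Y n)) \<in> borel_measurable lebesgue"
      by (auto simp: has_bochner_integral_iff)
    show ?thesis unfolding g_def[abs_def]
      by (intro borel_measurable_times borel_measurable_divide borel_measurable_indicator 1 2
          cut_weight_measurable[OF w]) simp
  qed
  have g: "g n z = (if Y n < z then K x z else 0)" for n z
  proof (cases "z \<in> {Y n<..<x}")
    case True
    then have "W z > 0" "K' z (Y n) > 0"
      using pos[of "Y n" z] Y(1)[of n] x by auto
    then show ?thesis using True by (simp add: g_def)
  next
    case False
    then show ?thesis by (auto simp: g_def cut_kernel_def)
  qed
  have lim: "(\<lambda>n. g n z) \<longlonglongrightarrow> K x z" if "z \<noteq> a" for z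
  proof (cases "z < a")
    case True
    then have "g n z = K x z" for n by (simp add: g cut_kernel_def)
    then show ?thesis by simp
  next
    case False
    then have "z > a" using \<open>z \<noteq> a\<close> by simp
    then obtain N where N: "1 / real (Suc N) < z - a" using nat_approx_posE[of "z - a"] by auto
    have "g n z = K x z" if "n \<ge> N" for n
    proof -
      have "1 / real (Suc n) \<le> 1 / real (Suc N)" using that by (simp add: field_simps)
      then have "Y n < z" using Y(2)[of n] N by simp
      then show ?thesis by (simp add: g)
    qed
    then show ?thesis
      by (intro tendsto_eventually) (auto simp: eventually_sequentially)
  qed
  \<comment> \<open>At \<open>z = a\<close> the limit fails: \<open>g n a = 0\<close> for all
    \<open>n\<close>, while \<open>K x a\<close> is positive. This single point is erased
    first.\<close>
  have "(\<lambda>z. if z = a then 0 else K x z) \<in> borel_measurable lebesgue"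
  proof (rule borel_measurable_LIMSEQ_real)
    show "(\<lambda>n. if z = a then 0 else g n z) \<longlonglongrightarrow> (if z = a then 0 else K x z)" for z
      using lim[of z] by simp
    show "(\<lambda>z. if z = a then 0 else g n z) \<in> borel_measurable lebesgue" for n
      by (rule borel_measurable_lebesgue_cong_AE[OF gm[of n]])
        (use AE_lborel_singleton[of a] in \<open>eventually_elim, simp\<close>)
  qed
  moreover have "AE z in lborel. K x z = (if z = a then 0 else K x z)"
    using AE_lborel_singleton[of a] by eventually_elim simp
  ultimately show ?thesis by (rule borel_measurable_lebesgue_cong_AE)
qed

lemma weighted_row_measurable:
  "a < x \<Longrightarrow> x \<le> b \<Longrightarrow> (\<lambda>z. K x z * W z) \<in> borel_measurable lebesgue"
  using row_measurable cut_weight_measurable[OF w] by measurable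

text \<open>The column at \<open>a\<close> could be among the exceptional sections. It occurs in the
  integrand of the composition of \<open>k'\<close> and \<open>k\<close> at \<open>(b, a)\<close>;
  the other factor, the row \<open>K' b\<close>, is measurable and positive on
  \<open>{a<..<b}\<close>.\<close>

lemma weighted_column_measurable:
  "(\<lambda>z. W z * K z a) \<in> borel_measurable lebesgue"
proof -
  interpret flip: conj_kernels a b \<omega> k' k by (rule flip)
  have "has_bochner_integral lebesgue (\<lambda>z. K' b z * W z * K z a) 1"
    using ab by (intro flip.composition_eq_1) auto
  then have 1: "(\<lambda>z. K' b z * W z * K z a) \<in> borel_measurable lebesgue"
    by (auto simp: has_bochner_integral_iff)
  have "(\<lambda>z. indicator {a<..<b} z * ((K' b z * W z * K z a) / K' b z)) \<in> borel_measurable lebesgue"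
    by (intro borel_measurable_times[OF borel_measurable_indicator borel_measurable_divide[OF 1]]
        flip.row_measurable) (use ab in simp_all)
  moreover have "AE z in lborel. W z * K z a = indicator {a<..<b} z * ((K' b z * W z * K z a) / K' b z)"
    using AE_lborel_singleton[of b]
  proof eventually_elim
    case (elim z)
    show ?case
    proof (cases "z \<in> {a<..<b}")
      case True
      then have "K' b z > 0" using pos[of z b] by simp
      then show ?thesis using True by simp
    next
      case False
      then show ?thesis using elim by (auto simp: cut_kernel_def)
    qed
  qed
  ultimately show ?thesis by (rule borel_measurable_lebesgue_cong_AE)
qed

text \<open>Fubini with the weighted row as \<open>p\<close>, where the composed kernel is the
  indicator of \<open>{a..<x}\<close>. The function \<open>u\<close> already contains the weight, so
  that a plain integral results.\<close>

lemma inversion: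
  assumes x: "a < x" "x \<le> b" and u: "u \<in> borel_measurable lebesgue" "set_integrable lebesgue {a..<x} u"
  shows "integrable lebesgue (\<lambda>t. K x t * W t * (\<integral>s. K' t s * u s \<partial>lebesgue))"
    and "(\<integral>t. K x t * W t * (\<integral>s. K' t s * u s \<partial>lebesgue) \<partial>lebesgue) = (LINT s:{a..<x}|lebesgue. u s)"
proof -
  have "(\<integral>\<^sup>+s. (\<integral>\<^sup>+t. ennreal (K x t * W t * K' t s) \<partial>lebesgue) * ennreal \<bar>u s\<bar> \<partial>lebesgue)
      = (\<integral>\<^sup>+s. ennreal (norm (indicator {a..<x} s *\<^sub>R u s)) \<partial>lebesgue)"
    unfolding composition_nn[OF x(2)] by (intro nn_integral_cong) (simp add: indicator_def)
  also have "\<dots> < \<infinity>"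
    using u(2) by (simp add: set_integrable_def integrable_iff_bounded)
  finally have fin: "(\<integral>\<^sup>+s. (\<integral>\<^sup>+t. ennreal (K x t * W t * K' t s) \<partial>lebesgue) * ennreal \<bar>u s\<bar> \<partial>lebesgue) < \<infinity>" .
  have nn: "K x t * W t \<ge> 0" for t using nonneg by simp
  note F = lebesgue_Fubini_weighted[OF cut_kernel_measurable[OF k'] nonneg(3) weighted_row_measurable[OF x] nn u(1) fin]
  show "integrable lebesgue (\<lambda>t. K x t * W t * (\<integral>s. K' t s * u s \<partial>lebesgue))" by (rule F(2))
  have "(\<integral>t. K x t * W t * (\<integral>s. K' t s * u s \<partial>lebesgue) \<partial>lebesgue) = (\<integral>s. indicator {a..<x} s * u s \<partial>lebesgue)"
  proof (rule F(3))
    show "(\<lambda>s. indicat_real {a..<x} s) \<in> borel_measurable lebesgue"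
      by (rule borel_measurable_indicator) simp
  qed (simp_all add: composition_nn[OF x(2)])
  then show "(\<integral>t. K x t * W t * (\<integral>s. K' t s * u s \<partial>lebesgue) \<partial>lebesgue) = (LINT s:{a..<x}|lebesgue. u s)"
    by (simp add: set_lebesgue_integral_def)
qed

text \<open>
  Insert the factor \<open>1\<close>, the composition of \<open>k'\<close> and \<open>k\<close> at \<open>(t, a)\<close>, under the left-hand
  integral and exchange the order of integration.
\<close>

lemma row_integral_eq_column_integral_nn:
  assumes x: "a < x" "x \<le> b"
  shows "(\<integral>\<^sup>+t. ennreal (K x t * W t) \<partial>lebesgue) = (\<integral>\<^sup>+s. ennreal (indicator {a..<x} s * (W s * K s a)) \<partial>lebesgue)"
proof -
  interpret flip: conj_kernels a b \<omega> k' k by (rule flip)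
  have "(\<lambda>p. ennreal (case p of (x, y) \<Rightarrow> K' x y)) \<in> borel_measurable lebesgue"
    using cut_kernel_measurable[OF k'] by measurable
  then have K'm: "(\<lambda>(x, y). ennreal (K' x y)) \<in> borel_measurable lebesgue" by (simp add: case_prod_unfold)
  have um: "(\<lambda>t. ennreal (K x t * W t)) \<in> borel_measurable lebesgue"
    using weighted_row_measurable[OF x] by measurable
  have vm: "(\<lambda>t. ennreal (W t * K t a)) \<in> borel_measurable lebesgue"
    using weighted_column_measurable by measurable
  have c: "(\<integral>\<^sup>+s. ennreal (K' t s) * ennreal (W s * K s a) \<partial>lebesgue) = ennreal (indicator {a..<t} a)" if "t \<le> b" for t
    using flip.composition_nn[OF that, of a] nonneg by (simp add: ennreal_mult[symmetric] mult.assoc)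
  have "(\<integral>\<^sup>+t. ennreal (K x t * W t) \<partial>lebesgue) =
      (\<integral>\<^sup>+t. ennreal (K x t * W t) * (\<integral>\<^sup>+s. ennreal (K' t s) * ennreal (W s * K s a) \<partial>lebesgue) \<partial>lebesgue)"
  proof (rule nn_integral_cong_AE)
    \<comment> \<open>At \<open>t = a\<close> the composed kernel is 0 instead of 1.\<close>
    have "AE t in lebesgue. t \<noteq> a" using AE_completion[OF AE_lborel_singleton[of a]] .
    then show "AE t in lebesgue. ennreal (K x t * W t) =
        ennreal (K x t * W t) * (\<integral>\<^sup>+s. ennreal (K' t s) * ennreal (W s * K s a) \<partial>lebesgue)"
    proof eventually_elim
      case (elim t)
      show ?case
      proof (cases "a < t \<and> t \<le> b")
        case True
        then show ?thesis using c[of t] by simp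
      next
        case False
        then have "W t = 0" using elim by (auto simp: cut_weight_def)
        then show ?thesis by simp
      qed
    qed
  qed
  also have "\<dots> = (\<integral>\<^sup>+s. (\<integral>\<^sup>+t. ennreal (K x t * W t) * ennreal (K' t s) \<partial>lebesgue) * ennreal (W s * K s a) \<partial>lebesgue)"
    by (rule lebesgue_Tonelli(1)[OF K'm um vm])
  also have "\<dots> = (\<integral>\<^sup>+s. ennreal (indicator {a..<x} s) * ennreal (W s * K s a) \<partial>lebesgue)"
    using composition_nn[OF x(2)] nonneg by (simp add: ennreal_mult[symmetric])
  also have "\<dots> = (\<integral>\<^sup>+s. ennreal (indicator {a..<x} s * (W s * K s a)) \<partial>lebesgue)"
    using nonneg by (simp add: ennreal_mult)
  finally show ?thesis .
qed

text \<open>Rows are known to be integrable only almost everywhere, but column integrals grow with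
  the endpoint. The one up to \<open>x\<close> is bounded by the one up to a good \<open>y\<close>
  with \<open>x < y < b\<close>, which equals the finite integral of row \<open>y\<close>.\<close>

lemma row_integral_eq_column_integral:
  assumes x: "a < x" "x < b"
  shows "integrable lebesgue (\<lambda>t. K x t * W t)"
    and "set_integrable lebesgue {a..<x} (\<lambda>s. W s * K s a)"
    and "(\<integral>t. K x t * W t \<partial>lebesgue) = (LINT s:{a..<x}|lebesgue. W s * K s a)"
proof -
  have xb: "x \<le> b" using x by simp
  obtain y where y: "x < y" "y < b" "integrable lebesgue (\<lambda>t. K y t * W t)"
    using AE_lebesgue_ex_between[OF cut_kernel_G_finite[OF w k] x(2)] by metis
  have ay: "a < y" "y \<le> b" using x y by auto
  let ?r = "\<lambda>t. K x t * W t" and ?c = "\<lambda>s. indicator {a..<x} s * (W s * K s a)"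
  have "(\<integral>\<^sup>+s. ennreal (?c s) \<partial>lebesgue) \<le> (\<integral>\<^sup>+s. ennreal (indicator {a..<y} s * (W s * K s a)) \<partial>lebesgue)"
    by (rule nn_integral_mono, rule ennreal_leI) (use y nonneg in \<open>auto simp: indicator_def\<close>)
  also have "\<dots> = (\<integral>\<^sup>+t. ennreal (K y t * W t) \<partial>lebesgue)"
    by (rule row_integral_eq_column_integral_nn[OF ay, symmetric])
  also have "\<dots> < \<infinity>"
    using y(3) nonneg by (subst nn_integral_eq_integral) simp_all
  finally have fin: "(\<integral>\<^sup>+s. ennreal (?c s) \<partial>lebesgue) < \<infinity>" .
  note eq = row_integral_eq_column_integral_nn[OF x(1) xb]
  have cm: "?c \<in> borel_measurable lebesgue"
    by (rule borel_measurable_times[OF borel_measurable_indicator weighted_column_measurable]) simp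
  have ci: "integrable lebesgue ?c"
    by (rule integrableI_nonneg[OF cm]) (use fin nonneg in auto)
  have ri: "integrable lebesgue ?r"
    by (rule integrableI_nonneg[OF weighted_row_measurable[OF x(1) xb]]) (use fin eq nonneg in auto)
  show "integrable lebesgue ?r" by (rule ri)
  show "set_integrable lebesgue {a..<x} (\<lambda>s. W s * K s a)"
    using ci by (simp add: set_integrable_def)
  have "integral\<^sup>L lebesgue ?r = enn2real (\<integral>\<^sup>+t. ennreal (?r t) \<partial>lebesgue)"
    using nonneg by (intro integral_eq_nn_integral borel_measurable_integrable[OF ri]) simp
  also have "\<dots> = integral\<^sup>L lebesgue ?c"
    unfolding eq using nonneg by (intro integral_eq_nn_integral[symmetric] cm) simp
  finally show "(\<integral>t. K x t * W t \<partial>lebesgue) = (LINT s:{a..<x}|lebesgue. W s * K s a)"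
    by (simp add: set_lebesgue_integral_def)
qed

end

section \<open>Transfer of the given data to integrals over the whole line\<close>

lemma k_integral_eq_cutoff:
  assumes "x \<le> b"
  shows "k_integral a \<omega> k f x = (\<integral>s. cut_kernel a b k x s * (f s * cut_weight a b \<omega> s) \<partial>lebesgue)"
  unfolding k_integral_def
  by (rule lebesgue_on_eq_cutoff(2)) (use assms in \<open>auto simp: cut_kernel_def cut_weight_def\<close>)

lemma integrable_mult_cut_weight:
  assumes w: "weight a b \<omega>" and f: "integrable (lebesgue_on {a..b}) f"
  shows "integrable lebesgue (\<lambda>s. f s * cut_weight a b \<omega> s)"
proof -
  define g where "g s = (if s \<in> {a..b} then f s else 0)" for s
  have S: "{a..b} \<in> sets lebesgue" by simp
  have g: "integrable lebesgue g"
    by (rule iffD1[OF lebesgue_on_eq_cutoff(1)[OF S] f]) (auto simp: g_def)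
  obtain C where C: "C \<ge> 0" "AE x in lebesgue. cut_weight a b \<omega> x \<le> C"
    by (rule cut_weight_bounded[OF w])
  have "integrable lebesgue (\<lambda>s. g s * cut_weight a b \<omega> s)"
  proof (rule Bochner_Integration.integrable_bound)
    show "integrable lebesgue (\<lambda>s. C * g s)" using g by simp
    show "(\<lambda>s. g s * cut_weight a b \<omega> s) \<in> borel_measurable lebesgue"
      by (intro borel_measurable_times borel_measurable_integrable[OF g] cut_weight_measurable[OF w])
    show "AE s in lebesgue. norm (g s * cut_weight a b \<omega> s) \<le> norm (C * g s)"
      using C(2)
    proof eventually_elim
      case (elim s)
      then have "\<bar>g s\<bar> * \<bar>cut_weight a b \<omega> s\<bar> \<le> \<bar>g s\<bar> * \<bar>C\<bar>"
        using cut_weight_nonneg[OF w, of s] C(1) by (intro mult_left_mono) auto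
      then show ?case by (simp add: abs_mult mult.commute)
    qed
  qed
  also have "(\<lambda>s. g s * cut_weight a b \<omega> s) = (\<lambda>s. f s * cut_weight a b \<omega> s)"
    by (auto simp: g_def cut_weight_def)
  finally show ?thesis .
qed

lemma abs_cont_on_imp_LINT:
  assumes ab: "a < b" and ac: "abs_cont_on a b h"
  obtains q where "integrable lebesgue q" "\<And>x. x \<notin> {a..b} \<Longrightarrow> q x = 0"
    "\<And>x. x \<in> {a..b} \<Longrightarrow> h x = h a + (LINT t:{a..<x}|lebesgue. q t)"
    "AE x in lebesgue. a < x \<and> x < b \<longrightarrow> (h has_real_derivative q x) (at x)"
proof -
  obtain q where q: "integrable lborel q" "q \<in> borel_measurable borel" "\<And>x. x \<notin> {a..b} \<Longrightarrow> q x = 0"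
    "\<And>x. x \<in> {a..b} \<Longrightarrow> h x = h a + (\<integral>t. indicator {a..x} t * q t \<partial>lborel)"
    using abs_cont_on_imp_indefinite_integral[OF ab ac] by blast
  have qi: "integrable lebesgue q" using q(1,2) by (simp add: integrable_completion)
  have eq: "h x = h a + (LINT t:{a..<x}|lebesgue. q t)" if "x \<in> {a..b}" for x
  proof -
    have "(\<integral>t. indicator {a..x} t * q t \<partial>lborel) = (\<integral>t. indicator {a..<x} t * q t \<partial>lborel)"
    proof (rule integral_cong_AE)
      show "AE t in lborel. indicator {a..x} t * q t = indicator {a..<x} t * q t"
        using AE_lborel_singleton[of x] by eventually_elim (auto simp: indicator_def)
    qed (use q(2) in measurable)
    also have "\<dots> = (\<integral>t. indicator {a..<x} t * q t \<partial>lebesgue)"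
      using q(2) by (intro integral_completion[symmetric]) measurable
    finally show ?thesis
      using q(4)[OF that] by (simp add: set_lebesgue_integral_def)
  qed
  have "set_integrable lebesgue {a..<x} q" for x
    unfolding set_integrable_def by (rule integrable_mult_indicator[OF _ qi]) simp
  then have "AE x in lebesgue. a < x \<and> x < b \<longrightarrow>
      ((\<lambda>x. LINT t:{a..<x}|lebesgue. q t) has_real_derivative q x) (at x)"
    by (rule AE_has_real_derivative_LINT)
  then have "AE x in lebesgue. a < x \<and> x < b \<longrightarrow> (h has_real_derivative q x) (at x)"
  proof eventually_elim
    case (elim x)
    show ?case
    proof
      assume x: "a < x \<and> x < b"
      then have "((\<lambda>x. h a + (LINT t:{a..<x}|lebesgue. q t)) has_real_derivative 0 + q x) (at x)"
        using elim by (intro DERIV_add DERIV_const) blast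
      then show "(h has_real_derivative q x) (at x)"
        unfolding add_0
      proof (rule has_field_derivative_transform_within_open)
        show "h a + (LINT t:{a..<y}|lebesgue. q t) = h y" if "y \<in> {a<..<b}" for y
          using eq[of y] that by simp
      qed (use x in auto)
    qed
  qed
  with qi q(3) eq show ?thesis by (rule that)
qed

context conj_kernels
begin

text \<open>On the left \<open>x\<close> enters through the row of the kernel, which need not vary
  regularly. The column form moves it to the limit of integration, where differentiation is
  possible.\<close>

lemma ker_delta_unit:
  assumes x: "a < x" "x < b"
  shows "ker_delta \<omega> k unit_kernel x a = (LINT s:{a..<x}|lebesgue. W s * K s a)"
proof -
  have xb: "x \<le> b" using x by simp
  let ?g = "\<lambda>z. indicator {a<..<x} z * (K x z * W z)"
  have "ker_delta \<omega> k unit_kernel x a = integral\<^sup>L lebesgue ?g"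
    unfolding ker_delta_def
    by (rule lebesgue_on_eq_cutoff(2)) (use x in \<open>auto simp: cut_kernel_def cut_weight_def unit_kernel_def\<close>)
  also have "\<dots> = (\<integral>t. K x t * W t \<partial>lebesgue)"
  proof (rule integral_cong_AE)
    show m: "(\<lambda>t. K x t * W t) \<in> borel_measurable lebesgue" by (rule weighted_row_measurable[OF x(1) xb])
    show "?g \<in> borel_measurable lebesgue"
      by (rule borel_measurable_times[OF borel_measurable_indicator m]) simp
    show "AE z in lebesgue. ?g z = K x z * W z"
      using AE_completion[OF AE_lborel_singleton[of a]]
      by eventually_elim (auto simp: cut_kernel_def indicator_def)
  qed
  also have "\<dots> = (LINT s:{a..<x}|lebesgue. W s * K s a)"
    by (rule row_integral_eq_column_integral(3)[OF x])
  finally show ?thesis .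
qed

text \<open>The weighted row \<open>x\<close> is integrated against the almost everywhere identity
  of the \<open>k'\<close>-integral with \<open>h\<close>, so the outcome holds at every
  \<open>x\<close> of the open interval.\<close>

lemma integrated_identity:
  assumes f: "integrable (lebesgue_on {a..b}) f"
    and h: "AE x in lebesgue. x \<in> {a..b} \<longrightarrow> k_integral a \<omega> k' f x = h x"
    and q: "integrable lebesgue q" "\<And>x. x \<in> {a..b} \<Longrightarrow> h x = h a + (LINT t:{a..<x}|lebesgue. q t)"
    and x: "a < x" "x < b"
  shows "(LINT s:{a..<x}|lebesgue. f s * W s) =
    h a * (LINT s:{a..<x}|lebesgue. W s * K s a) + (LINT s:{a..<x}|lebesgue. W s * (\<integral>r. K s r * q r \<partial>lebesgue))"
proof -
  interpret flip: conj_kernels a b \<omega> k' k by (rule flip)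
  have xb: "x \<le> b" using x by simp
  have set: "set_integrable lebesgue {a..<y} u" if "integrable lebesgue u" for y and u :: "real \<Rightarrow> real"
    unfolding set_integrable_def by (rule integrable_mult_indicator[OF _ that]) simp
  note fW = integrable_mult_cut_weight[OF w f]
  \<comment> \<open>The weight times the \<open>k\<close>-integral of \<open>q / \<omega>\<close>;
    the weight inside that integral has cancelled.\<close>
  define v where "v s = W s * (\<integral>r. K s r * q r \<partial>lebesgue)" for s
  have v: "integrable lebesgue v"
    unfolding v_def[abs_def] by (rule integrable_weight_kernel_operator[OF w k q(1)])
  note If = inversion[OF x(1) xb borel_measurable_integrable[OF fW] set[OF fW]]
  note Iv = inversion[OF x(1) xb borel_measurable_integrable[OF v] set[OF v]]
  note r = row_integral_eq_column_integral[OF x]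
  let ?R = "\<lambda>t. h a * (K x t * W t) + K x t * W t * (\<integral>s. K' t s * v s \<partial>lebesgue)"
  have Ri: "integrable lebesgue ?R" using r(1) Iv(1) by simp
  have "(LINT s:{a..<x}|lebesgue. f s * W s) =
      (\<integral>t. K x t * W t * (\<integral>s. K' t s * (f s * W s) \<partial>lebesgue) \<partial>lebesgue)"
    by (rule If(2)[symmetric])
  also have "\<dots> = integral\<^sup>L lebesgue ?R"
  proof (rule integral_cong_AE[OF borel_measurable_integrable[OF If(1)] borel_measurable_integrable[OF Ri]])
    have "AE t in lebesgue. t \<noteq> a" using AE_completion[OF AE_lborel_singleton[of a]] .
    with h show "AE t in lebesgue. K x t * W t * (\<integral>s. K' t s * (f s * W s) \<partial>lebesgue) = ?R t"
    proof eventually_elim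
      case (elim t)
      show ?case
      proof (cases "a < t \<and> t \<le> b")
        case True
        then have t: "a < t" "t \<le> b" by auto
        have "(\<integral>s. K' t s * (f s * W s) \<partial>lebesgue) = h t"
          using elim(1) t k_integral_eq_cutoff[OF t(2), of a \<omega> k' f] by simp
        also have "h t = h a + (LINT s:{a..<t}|lebesgue. q s)" using q(2)[of t] t by simp
        \<comment> \<open>Inversion in the other order writes the plain integral of \<open>q\<close>
          as \<open>K'\<close> applied to \<open>v\<close>, ready for the row \<open>K x\<close> to
          be inverted against it.\<close>
        also have "(LINT s:{a..<t}|lebesgue. q s) = (\<integral>z. K' t z * W z * (\<integral>s. K z s * q s \<partial>lebesgue) \<partial>lebesgue)"
          by (rule flip.inversion(2)[OF t borel_measurable_integrable[OF q(1)] set[OF q(1)], symmetric])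
        also have "\<dots> = (\<integral>s. K' t s * v s \<partial>lebesgue)" by (simp add: v_def mult.assoc)
        finally show ?thesis by (simp add: algebra_simps)
      next
        case False
        then have "W t = 0" using elim(2) by (auto simp: cut_weight_def)
        then show ?thesis by simp
      qed
    qed
  qed
  also have "\<dots> = h a * (\<integral>t. K x t * W t \<partial>lebesgue) + (\<integral>t. K x t * W t * (\<integral>s. K' t s * v s \<partial>lebesgue) \<partial>lebesgue)"
    using r(1) Iv(1) by simp
  also have "\<dots> = h a * (LINT s:{a..<x}|lebesgue. W s * K s a) + (LINT s:{a..<x}|lebesgue. v s)"
    unfolding r(3) Iv(2) ..
  finally show ?thesis by (simp add: v_def)
qed

text \<open>Both sides of the integrated identity are combinations of indefinite integrals. Their
  derivatives carry the common factor \<open>W x\<close>, which is positive inside the interval and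
  cancels.\<close>

lemma k_integral_of_derivative:
  assumes f: "integrable (lebesgue_on {a..b}) f"
    and h: "abs_cont_on a b h" "AE x in lebesgue. x \<in> {a..b} \<longrightarrow> k_integral a \<omega> k' f x = h x"
  shows "AE x in lebesgue. a < x \<and> x < b \<longrightarrow>
    (\<lambda>t. ker_delta \<omega> k unit_kernel t a) differentiable (at x) \<and>
    k_integral a \<omega> k (\<lambda>x. 1 / \<omega> x * deriv h x) x =
      f x - h a * (1 / \<omega> x * deriv (\<lambda>t. ker_delta \<omega> k unit_kernel t a) x)"
proof -
  obtain q where q: "integrable lebesgue q" "\<And>x. x \<notin> {a..b} \<Longrightarrow> q x = 0"
    "\<And>x. x \<in> {a..b} \<Longrightarrow> h x = h a + (LINT t:{a..<x}|lebesgue. q t)"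
    "AE x in lebesgue. a < x \<and> x < b \<longrightarrow> (h has_real_derivative q x) (at x)"
    using abs_cont_on_imp_LINT[OF ab h(1)] by blast
  have set: "set_integrable lebesgue {a..<y} u" if "integrable lebesgue u" for y and u :: "real \<Rightarrow> real"
    unfolding set_integrable_def by (rule integrable_mult_indicator[OF _ that]) simp
  define v where "v s = W s * (\<integral>r. K s r * q r \<partial>lebesgue)" for s
  have v: "integrable lebesgue v"
    unfolding v_def[abs_def] by (rule integrable_weight_kernel_operator[OF w k q(1)])
  \<comment> \<open>Almost everywhere inside the interval \<open>deriv h\<close> is
    \<open>q\<close>, and the weight cancels. The endpoints are discarded because \<open>h\<close>
    is arbitrary outside \<open>{a..b}\<close>.\<close>
  have hdq: "AE s in lebesgue. q s = 1 / \<omega> s * deriv h s * W s"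
    using q(4) AE_completion[OF AE_lborel_singleton[of a]] AE_completion[OF AE_lborel_singleton[of b]]
  proof eventually_elim
    case (elim s)
    show ?case
    proof (cases "s \<in> {a..b}")
      case True
      then have "deriv h s = q s" using elim by (intro DERIV_imp_deriv) auto
      moreover have "\<omega> s > 0" using w True by (simp add: weight_def)
      ultimately show ?thesis using True by (simp add: cut_weight_def)
    next
      case False
      then show ?thesis using q(2) by (auto simp: cut_weight_def)
    qed
  qed
  have kd: "k_integral a \<omega> k (\<lambda>x. 1 / \<omega> x * deriv h x) x = (\<integral>s. K x s * q s \<partial>lebesgue)"
    if x: "a < x" "x < b" for x
  proof -
    have eq: "AE s in lebesgue. K x s * q s = K x s * (1 / \<omega> s * deriv h s * W s)"
      using hdq by eventually_elim simp
    have m: "(\<lambda>s. K x s * q s) \<in> borel_measurable lebesgue"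
      using x by (intro borel_measurable_times row_measurable borel_measurable_integrable[OF q(1)]) auto
    have "k_integral a \<omega> k (\<lambda>x. 1 / \<omega> x * deriv h x) x =
        (\<integral>s. K x s * (1 / \<omega> s * deriv h s * W s) \<partial>lebesgue)"
      by (rule k_integral_eq_cutoff) (use x in simp)
    also have "\<dots> = (\<integral>s. K x s * q s \<partial>lebesgue)"
      by (rule integral_cong_AE[symmetric, OF m borel_measurable_AE[OF m eq] eq])
    finally show ?thesis .
  qed
  note fW = integrable_mult_cut_weight[OF w f]
  have "AE x in lebesgue. a < x \<and> x < b \<longrightarrow>
      ((\<lambda>x. LINT t:{a..<x}|lebesgue. W t * K t a) has_real_derivative W x * K x a) (at x)"
    by (rule AE_has_real_derivative_LINT) (rule row_integral_eq_column_integral(2))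
  moreover have "AE x in lebesgue. a < x \<and> x < b \<longrightarrow>
      ((\<lambda>x. LINT t:{a..<x}|lebesgue. f t * W t) has_real_derivative f x * W x) (at x)"
    by (rule AE_has_real_derivative_LINT) (rule set[OF fW])
  moreover have "AE x in lebesgue. a < x \<and> x < b \<longrightarrow>
      ((\<lambda>x. LINT t:{a..<x}|lebesgue. v t) has_real_derivative v x) (at x)"
    by (rule AE_has_real_derivative_LINT) (rule set[OF v])
  ultimately show ?thesis
  proof eventually_elim
    case (elim x)
    show ?case
    proof (intro impI)
      assume x: "a < x \<and> x < b"
      have D1: "((\<lambda>x. LINT t:{a..<x}|lebesgue. W t * K t a) has_real_derivative W x * K x a) (at x)"
        and D2: "((\<lambda>x. LINT t:{a..<x}|lebesgue. f t * W t) has_real_derivative f x * W x) (at x)"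
        and D3: "((\<lambda>x. LINT t:{a..<x}|lebesgue. v t) has_real_derivative v x) (at x)"
        using elim x by blast+
      have "((\<lambda>x. h a * (LINT t:{a..<x}|lebesgue. W t * K t a) + (LINT t:{a..<x}|lebesgue. v t))
          has_real_derivative h a * (W x * K x a) + v x) (at x)"
        by (intro DERIV_add DERIV_cmult D1 D3)
      \<comment> \<open>The identity holds on the neighbourhood \<open>{a<..<b}\<close> of
        \<open>x\<close>, so a second derivative value is obtained for the function treated in
        \<open>D2\<close>, and the two must agree.\<close>
      then have "((\<lambda>x. LINT t:{a..<x}|lebesgue. f t * W t) has_real_derivative h a * (W x * K x a) + v x) (at x)"
      proof (rule has_field_derivative_transform_within_open)
        show "h a * (LINT t:{a..<y}|lebesgue. W t * K t a) + (LINT t:{a..<y}|lebesgue. v t) =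
            (LINT t:{a..<y}|lebesgue. f t * W t)" if "y \<in> {a<..<b}" for y
          using integrated_identity[OF f h(2) q(1,3), of y] that by (simp add: v_def)
      qed (use x in auto)
      with D2 have "f x * W x = h a * (W x * K x a) + v x" by (rule DERIV_unique)
      then have "W x * f x = W x * (h a * K x a + (\<integral>r. K x r * q r \<partial>lebesgue))"
        by (simp add: v_def algebra_simps)
      moreover have W: "W x = \<omega> x" "\<omega> x > 0" using x w by (auto simp: cut_weight_def weight_def)
      ultimately have "f x = h a * K x a + (\<integral>r. K x r * q r \<partial>lebesgue)" by simp
      then have I: "(\<integral>r. K x r * q r \<partial>lebesgue) = f x - h a * (1 / \<omega> x * (W x * K x a))"
        using W by simp
      from D1 have D: "((\<lambda>t. ker_delta \<omega> k unit_kernel t a) has_real_derivative W x * K x a) (at x)"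
      proof (rule has_field_derivative_transform_within_open)
        show "(LINT t:{a..<y}|lebesgue. W t * K t a) = ker_delta \<omega> k unit_kernel y a" if "y \<in> {a<..<b}" for y
          using ker_delta_unit[of y] that by simp
      qed (use x in auto)
      then have "(\<lambda>t. ker_delta \<omega> k unit_kernel t a) differentiable (at x)"
        by (auto simp: real_differentiable_def)
      moreover have "k_integral a \<omega> k (\<lambda>x. 1 / \<omega> x * deriv h x) x =
          f x - h a * (1 / \<omega> x * deriv (\<lambda>t. ker_delta \<omega> k unit_kernel t a) x)"
        using kd[of x] x I DERIV_imp_deriv[OF D] by simp
      ultimately show "(\<lambda>t. ker_delta \<omega> k unit_kernel t a) differentiable (at x) \<and>
          k_integral a \<omega> k (\<lambda>x. 1 / \<omega> x * deriv h x) x =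
          f x - h a * (1 / \<omega> x * deriv (\<lambda>t. ker_delta \<omega> k unit_kernel t a) x)" ..
    qed
  qed
qed

end

text \<open>Since \<open>deriv\<close> is a total function, differentiability is asserted together
  with the equation, so that the last term has its intended meaning. The argument works for
  whichever absolutely continuous representative \<open>ac_rep\<close> selects.\<close>

theorem theorem4p10:
  fixes a b :: real and \<omega> f :: "real \<Rightarrow> real" and k k' :: "real \<Rightarrow> real \<Rightarrow> real"
  assumes "a < b"
    and "weight a b \<omega>"
    and "k' \<in> kernels a b \<omega>"
    and "k \<in> conj_set a b \<omega> k'"
    and "integrable (lebesgue_on {a..b}) f"
    and "has_ac_rep a b (k_integral a \<omega> k' f)"
  shows "AE x in lebesgue_on {a..b}.
           (\<lambda>t. ker_delta \<omega> k unit_kernel t a) differentiable (at x) \<and>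
           k_integral a \<omega> k (k_derivative a b \<omega> k' f) x =
             f x - ac_rep a b (k_integral a \<omega> k' f) a *
                   (1 / \<omega> x * deriv (\<lambda>t. ker_delta \<omega> k unit_kernel t a) x)"
proof -
  interpret conj_kernels a b \<omega> k k'
    using assms by unfold_locales (auto simp: conj_set_def)
  define h where "h = ac_rep a b (k_integral a \<omega> k' f)"
  have "is_ac_rep a b (k_integral a \<omega> k' f) h"
    unfolding h_def ac_rep_def using assms(6) unfolding has_ac_rep_def by (rule someI_ex)
  then have h: "abs_cont_on a b h" "AE x in lebesgue_on {a..b}. k_integral a \<omega> k' f x = h x"
    by (auto simp: is_ac_rep_def)
  have h': "AE x in lebesgue. x \<in> {a..b} \<longrightarrow> k_integral a \<omega> k' f x = h x"
    using h(2) by (subst (asm) AE_lebesgue_on_iff) simp_all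
  have D: "k_derivative a b \<omega> k' f = (\<lambda>x. 1 / \<omega> x * deriv h x)"
    by (simp add: fun_eq_iff k_derivative_def h_def)
  have S: "{a..b} \<in> sets lebesgue" by simp
  show ?thesis
    unfolding h_def[symmetric] D AE_lebesgue_on_iff[OF S]
    using k_integral_of_derivative[OF assms(5) h(1) h']
      AE_completion[OF AE_lborel_singleton[of a]] AE_completion[OF AE_lborel_singleton[of b]]
    by eventually_elim auto
qed

end
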